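(* Let $(n_1,n_2,n_3)$ and $(n_1',n_2',n_3')$ be triples with $3\le n_1\le n_2\le n_3$ and $3\le n_1'\le n_2'\le n_3'$, all entries being integers or $\infty$. Suppose $(n_1,n_2,n_3)$ has type A. If $n_1'\le n_1$, $n_2'\le n_2$ and $n_3'\ge n_3$, then $(n_1',n_2',n_3')$ also has type A.
   Context: Complex hyperbolic plane. $\mathbb{C}^{2,1}$ is $\mathbb{C}^3$ with the Hermitian form $\langle u,v\rangle=u_1\overline{v_1}+u_2\overline{v_2}-u_3\overline{v_3}$. The complex hyperbolic plane $\mathbb{H}^2_{\mathbb{C}}$ is the projectivization of $\{v:\langle v,v\rangle<0\}$, with ideal boundary the projectivization of $\{v\neq0:\langle v,v\rangle=0\}$. $PU(2,1)$, the projectivization of $SU(2,1)$, acts on it by holomorphic isometries. An element of $PU(2,1)$ is elliptic if it fixes at least one point of $\mathbb{H}^2_{\mathbb{C}}$. A vector $\mathbf{c}$ with $\langle\mathbf{c},\mathbf{c}\rangle>0$ (a polar vector) determines the complex geodesic (complex slice) orthogonal to it, and the complex reflection $I_{\mathbf{c}}(\mathbf{v})=-\mathbf{v}+\frac{2\langle\mathbf{v},\mathbf{c}\rangle}{\langle\mathbf{c},\mathbf{c}\rangle}\mathbf{c}$, whose fixed point set is that complex geodesic. Two complex geodesics with polar vectors $c,c'$ normalized by $\langle c,c\rangle=\langle c',c'\rangle=1$ meet at angle $\alpha$ iff $|\langle c,c'\rangle|=\cos\alpha$ (angle $0$: they meet at a point of the ideal boundary). Triangle groups. Indices are taken mod 3,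 and $\pi/\infty=0$. An $(n_1,n_2,n_3)$-triangle is a triple of complex geodesics $C_1,C_2,C_3$ such that $C_{k-1}$ and $C_{k+1}$ meet at angle $\pi/n_k$ for $k=1,2,3$. Let $I_k$ be the complex reflection in $C_k$; the associated $(n_1,n_2,n_3)$-triangle group is the subgroup of $PU(2,1)$ generated by $I_1,I_2,I_3$. With polar vectors $c_k$ of $C_k$, let $\theta=\arg\left(\prod_{k=1}^3\langle c_{k-1},c_{k+1}\rangle/\prod_{k=1}^3\langle c_k,c_k\rangle\right)$, $t=\cos\theta$, $r_k=\cos(\pi/n_k)$, and $t_u=\min\left\{\frac{r_1^2+r_2^2+r_3^2-1}{2r_1r_2r_3},1\right\}$. For fixed $(n_1,n_2,n_3)$ the deformation space of $(n_1,n_2,n_3)$-triangle groups is parametrized by $t\in[-1,t_u)$. Types. Let $W_A=I_1I_3I_2I_3$ and $W_B=I_1I_2I_3$. The triple $(n_1,n_2,n_3)$ has type A if, as the parameter $t$ increases from $-1$ through the deformation space, $W_A$ becomes elliptic before $W_B$ does; otherwise it has type B. *)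

theory Defs
  imports "HOL-Analysis.Analysis" "HOL-Library.Extended_Nat"
begin

definition hform :: "complex ^ 3 \<Rightarrow> complex ^ 3 \<Rightarrow> complex" where
  "hform u v = u $ 1 * cnj (v $ 1) + u $ 2 * cnj (v $ 2) - u $ 3 * cnj (v $ 3)"

text \<open>\<^term>\<open>hform v v\<close> is always real, so its sign is that of its real part.\<close>

definition hnorm :: "complex ^ 3 \<Rightarrow> real" where
  "hnorm v = Re (hform v v)"

text \<open>A point of the projective plane is a complex line through the origin, as a set of vectors.\<close>

definition proj_point :: "complex ^ 3 \<Rightarrow> (complex ^ 3) set" where
  "proj_point v = range (\<lambda>a::complex. a *s v)"

definition hyperbolic_plane :: "(complex ^ 3) set set" where
  "hyperbolic_plane = {proj_point v | v. hnorm v < 0}"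

text \<open>
  An element of $PU(2,1)$ is given by a linear lift \<open>f\<close> and acts on projective points by taking
  images; the property below does not depend on the choice of the lift.
\<close>

definition elliptic :: "(complex ^ 3 \<Rightarrow> complex ^ 3) \<Rightarrow> bool" where
  "elliptic f \<longleftrightarrow> (\<exists>p \<in> hyperbolic_plane. f ` p = p)"

text \<open>A complex geodesic is given by a polar vector, which it determines up to a scalar.\<close>

definition polar :: "complex ^ 3 \<Rightarrow> bool" where
  "polar c \<longleftrightarrow> hnorm c > 0"

definition complex_reflection :: "complex ^ 3 \<Rightarrow> complex ^ 3 \<Rightarrow> complex ^ 3" where
  "complex_reflection c v = - v + (2 * hform v c / hform c c) *s c"

text \<open>
  The denominator normalizes the polar vectors. Geodesics meeting at an ideal point are those at
  angle \<open>0\<close>; the condition also holds for two equal geodesics, but a triangle with two equal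
  sides has parameter \<open>1\<close>, which lies outside every \<open>deformation_space\<close> below.
\<close>

definition meet_at_angle :: "complex ^ 3 \<Rightarrow> complex ^ 3 \<Rightarrow> real \<Rightarrow> bool" where
  "meet_at_angle c c' \<alpha> \<longleftrightarrow> cmod (hform c c') / (sqrt (hnorm c) * sqrt (hnorm c')) = cos \<alpha>"

definition pi_over :: "enat \<Rightarrow> real" where
  "pi_over m = (case m of enat k \<Rightarrow> pi / real k | \<infinity> \<Rightarrow> 0)"

text \<open>
  Triples are indexed by the numeral type \<^typ>\<open>3\<close>, whose arithmetic is modulo 3
  (so \<open>3 = 0\<close>).
\<close>

definition triangle :: "(3 \<Rightarrow> enat) \<Rightarrow> (3 \<Rightarrow> complex ^ 3) \<Rightarrow> bool" where
  "triangle n c \<longleftrightarrow>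
     (\<forall>k. polar (c k)) \<and> (\<forall>k. meet_at_angle (c (k - 1)) (c (k + 1)) (pi_over (n k)))"

definition triangle_param :: "(3 \<Rightarrow> complex ^ 3) \<Rightarrow> real" where
  "triangle_param c =
     cos (Arg ((\<Prod>k\<in>UNIV. hform (c (k - 1)) (c (k + 1))) / (\<Prod>k\<in>UNIV. hform (c k) (c k))))"

definition r_coeff :: "(3 \<Rightarrow> enat) \<Rightarrow> 3 \<Rightarrow> real" where
  "r_coeff n k = cos (pi_over (n k))"

definition t_upper :: "(3 \<Rightarrow> enat) \<Rightarrow> real" where
  "t_upper n =
     min (((r_coeff n 1)\<^sup>2 + (r_coeff n 2)\<^sup>2 + (r_coeff n 3)\<^sup>2 - 1)
            / (2 * r_coeff n 1 * r_coeff n 2 * r_coeff n 3)) 1"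

definition deformation_space :: "(3 \<Rightarrow> enat) \<Rightarrow> real set" where
  "deformation_space n = {-1..<t_upper n}"

definition word_A :: "(3 \<Rightarrow> complex ^ 3) \<Rightarrow> complex ^ 3 \<Rightarrow> complex ^ 3" where
  "word_A c = complex_reflection (c 1) \<circ> complex_reflection (c 3) \<circ>
              complex_reflection (c 2) \<circ> complex_reflection (c 3)"

definition word_B :: "(3 \<Rightarrow> complex ^ 3) \<Rightarrow> complex ^ 3 \<Rightarrow> complex ^ 3" where
  "word_B c = complex_reflection (c 1) \<circ> complex_reflection (c 2) \<circ> complex_reflection (c 3)"

text \<open>
  For a parameter in the deformation space the triangle exists and is unique up to a holomorphic or
  antiholomorphic isometry (the latter because the parameter determines the argument only up to
  sign), so that \<open>\<exists>c\<close> below could equally be \<open>\<forall>c\<close>.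
\<close>

definition elliptic_params ::
    "((3 \<Rightarrow> complex ^ 3) \<Rightarrow> complex ^ 3 \<Rightarrow> complex ^ 3) \<Rightarrow> (3 \<Rightarrow> enat) \<Rightarrow> real set" where
  "elliptic_params W n =
     {t \<in> deformation_space n. \<exists>c. triangle n c \<and> triangle_param c = t \<and> elliptic (W c)}"

text \<open>
  \<open>W\<^sub>A\<close> becomes elliptic before \<open>W\<^sub>B\<close>: some parameter at which \<open>W\<^sub>A\<close> is elliptic precedes all those at
  which \<open>W\<^sub>B\<close> is. This includes the case that only \<open>W\<^sub>A\<close> ever becomes elliptic.
\<close>

definition has_type_A :: "(3 \<Rightarrow> enat) \<Rightarrow> bool" where
  "has_type_A n \<longleftrightarrow>
     (\<exists>t \<in> elliptic_params word_A n. \<forall>s \<in> elliptic_params word_B n. t < s)"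

end

theory Submission
  imports Defs "HOL-Computational_Algebra.Fundamental_Theorem_Algebra"
begin

text \<open>
  Put $R_k = r_k^2$. The word $W_A$ is the product of the reflections in $c_1$ and $I_3(c_2)$, hence
  it becomes elliptic at an explicit parameter $t_A$. The word $W_B$ has trace
  $\tau = 3 - 4(R_1 + R_2 + R_3) + 8 r_1 r_2 r_3 e^{i\theta}$, and up to the boundary it is elliptic
  iff $\tau$ lies in the deltoid of traces of $SU(3)$. In the coordinates
  $w = 2 \mathrm{Re}\, \tau + 3$ and $g = |\tau|^2 + 12 \mathrm{Re}\, \tau + 9$ the deltoid is
  $g^2 \le 4 w^3$ (with a cusp at the origin), and as $t$ varies, $(w, g)$ runs along a straight line.
  Type A therefore means that this line has not met the cuspidal region up to $t_A$: it is still to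
  the left of the cusp there, or it has passed above it. At $t_A$ both $w$ and $g$ are polynomials in
  the $R_k$; where $w > 0$, all $R_k$ are at least $7/8$ (apart from
  the triple $(3,3,3)$, whose deformation space is empty), and there $w$ increases in $R_1, R_2$ and
  decreases in $R_3$, while $g$ does the opposite.
\<close>

section \<open>The Hermitian form and its isometries\<close>

lemma hform_add_left: "hform (u + v) w = hform u w + hform v w"
  and hform_add_right: "hform w (u + v) = hform w u + hform w v"
  and hform_diff_left: "hform (u - v) w = hform u w - hform v w"
  and hform_diff_right: "hform w (u - v) = hform w u - hform w v"
  and hform_minus_left: "hform (- u) w = - hform u w"
  and hform_minus_right: "hform w (- u) = - hform w u"
  and hform_scale_left: "hform (a *s u) w = a * hform u w"
  and hform_scale_right: "hform w (a *s u) = cnj a * hform w u"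
  by (simp_all add: hform_def algebra_simps)

lemmas hform_sesquilinear =
  hform_add_left hform_add_right hform_diff_left hform_diff_right
  hform_minus_left hform_minus_right hform_scale_left hform_scale_right

lemma cnj_hform: "cnj (hform u v) = hform v u"
  by (simp add: hform_def algebra_simps)

lemma hform_self: "hform v v = complex_of_real (hnorm v)"
  unfolding hnorm_def by (simp add: complex_eq_iff hform_def algebra_simps)

lemma hnorm_eq: "hnorm v = (cmod (v $ 1))\<^sup>2 + (cmod (v $ 2))\<^sup>2 - (cmod (v $ 3))\<^sup>2"
  by (simp add: hnorm_def hform_def cmod_power2) (simp add: power2_eq_square)

lemma vec3_eq_0: "v = 0 \<longleftrightarrow> v $ 1 = 0 \<and> v $ 2 = 0 \<and> v $ (3::3) = (0::complex)"
  by (simp add: vec_eq_iff forall_3)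

lemma cmod_eq_1_iff: "cmod z = 1 \<longleftrightarrow> z * cnj z = 1"
proof -
  have "z * cnj z = complex_of_real ((cmod z)\<^sup>2)" by (metis complex_norm_square)
  hence "z * cnj z = 1 \<longleftrightarrow> (cmod z)\<^sup>2 = 1" by (metis of_real_eq_1_iff)
  moreover have "cmod z \<noteq> - 1" using norm_ge_zero[of z] by linarith
  ultimately show ?thesis by (simp add: power2_eq_1_iff)
qed

text \<open>In signature (2,1) the orthogonal complement of a negative vector is positive definite.
  Cauchy-Schwarz in the first two coordinates gives \<open>C * D \<le> A * B\<close>, which together
  with \<open>A \<le> C\<close> and \<open>B < D\<close> forces \<open>u\<close> to vanish.\<close>

lemma hnorm_pos_if_orthogonal_negative:
  assumes "hnorm v < 0" and "hform u v = 0" and "u \<noteq> 0"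
  shows "hnorm u > 0"
proof (rule ccontr)
  assume "\<not> hnorm u > 0"
  define A where "A = (cmod (u $ 1))\<^sup>2 + (cmod (u $ 2))\<^sup>2"
  define B where "B = (cmod (v $ 1))\<^sup>2 + (cmod (v $ 2))\<^sup>2"
  define C where "C = (cmod (u $ 3))\<^sup>2"
  define D where "D = (cmod (v $ 3))\<^sup>2"
  have AC: "A \<le> C" and BD: "B < D" and nn: "0 \<le> A" "0 \<le> B"
    using assms(1) \<open>\<not> hnorm u > 0\<close> by (simp_all add: hnorm_eq A_def B_def C_def D_def)
  have "u $ 3 * cnj (v $ 3) = u $ 1 * cnj (v $ 1) + u $ 2 * cnj (v $ 2)"
    using assms(2) by (simp add: hform_def)
  hence "cmod (u $ 3) * cmod (v $ 3) \<le> cmod (u $ 1) * cmod (v $ 1) + cmod (u $ 2) * cmod (v $ 2)"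
    by (metis complex_mod_cnj norm_mult norm_triangle_ineq)
  hence "(cmod (u $ 3) * cmod (v $ 3))\<^sup>2
      \<le> (cmod (u $ 1) * cmod (v $ 1) + cmod (u $ 2) * cmod (v $ 2))\<^sup>2"
    by (intro power_mono) auto
  also have "\<dots> \<le> A * B"
    unfolding A_def B_def
    using zero_le_power2[of "cmod (u $ 1) * cmod (v $ 2) - cmod (u $ 2) * cmod (v $ 1)"]
    by (simp add: power2_eq_square algebra_simps)
  finally have "C * D \<le> A * B" by (simp add: C_def D_def power_mult_distrib)
  also have "\<dots> \<le> C * B" using AC nn by (intro mult_right_mono) auto
  finally have "C * (D - B) \<le> 0" by (simp add: algebra_simps)
  hence "C \<le> 0" using BD by (simp add: mult_le_0_iff)
  hence "A = 0" "C = 0" using AC nn C_def by auto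
  hence "u = 0" by (simp add: vec3_eq_0 A_def C_def add_nonneg_eq_0_iff)
  with assms(3) show False by simp
qed

section \<open>Linear isometries of the form and their fixed points\<close>

definition form_isometry :: "(complex ^ 3 \<Rightarrow> complex ^ 3) \<Rightarrow> bool" where
  "form_isometry f \<longleftrightarrow>
     (\<forall>u v. f (u + v) = f u + f v) \<and> (\<forall>a v. f (a *s v) = a *s f v) \<and>
     (\<forall>u v. hform (f u) (f v) = hform u v)"

lemma form_isometry_comp:
  "form_isometry f \<Longrightarrow> form_isometry g \<Longrightarrow> form_isometry (f \<circ> g)"
  by (simp add: form_isometry_def)

lemma form_isometry_reflection:
  assumes "hform c c = 1"
  shows "form_isometry (complex_reflection c)"
proof -
  have "hform (complex_reflection c u) (complex_reflection c v) = hform u v" for u v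
    by (simp add: complex_reflection_def hform_sesquilinear assms cnj_hform algebra_simps)
  moreover have "complex_reflection c (u + v) = complex_reflection c u + complex_reflection c v" for u v
    by (simp add: complex_reflection_def hform_sesquilinear assms vec_eq_iff algebra_simps)
  moreover have "complex_reflection c (a *s v) = a *s complex_reflection c v" for a v
    by (simp add: complex_reflection_def hform_sesquilinear assms vec_eq_iff algebra_simps)
  ultimately show ?thesis by (simp add: form_isometry_def)
qed

lemma complex_reflection_involution:
  "hform c c = 1 \<Longrightarrow> complex_reflection c (complex_reflection c v) = v"
  by (simp add: complex_reflection_def hform_sesquilinear vec_eq_iff algebra_simps)

text \<open>A fixed projective point is an eigenline; the form is nonzero on it, so preserving the
  form puts the eigenvalue on the unit circle.\<close>

lemma elliptic_iff_eigenvector: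
  assumes "form_isometry f"
  shows "elliptic f \<longleftrightarrow> (\<exists>v l. hnorm v < 0 \<and> f v = l *s v \<and> cmod l = 1)"
proof
  assume "elliptic f"
  then obtain v where v: "hnorm v < 0" and img: "f ` proj_point v = proj_point v"
    by (auto simp: elliptic_def hyperbolic_plane_def)
  have "v \<in> proj_point v" unfolding proj_point_def by (metis rangeI vector_smult_lid)
  hence "f v \<in> proj_point v" using img by blast
  then obtain l where l: "f v = l *s v" by (auto simp: proj_point_def)
  have "hform v v = l * cnj l * hform v v"
    using assms l unfolding form_isometry_def
    by (metis hform_scale_left hform_scale_right mult.assoc)
  moreover have "hform v v \<noteq> 0" using v by (simp add: hform_self)
  ultimately have "l * cnj l = 1" by simp
  hence "cmod l = 1" by (simp add: cmod_eq_1_iff)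
  with v l show "\<exists>v l. hnorm v < 0 \<and> f v = l *s v \<and> cmod l = 1" by blast
next
  assume "\<exists>v l. hnorm v < 0 \<and> f v = l *s v \<and> cmod l = 1"
  then obtain v l where v: "hnorm v < 0" and l: "f v = l *s v" and l1: "cmod l = 1" by blast
  have l0: "l \<noteq> 0" using l1 by auto
  have fa: "f (a *s v) = (a * l) *s v" for a
    using assms l by (simp add: form_isometry_def)
  have "f ` proj_point v = proj_point v"
  proof (intro equalityI subsetI)
    fix w assume "w \<in> f ` proj_point v"
    thus "w \<in> proj_point v" using fa by (auto simp: proj_point_def)
  next
    fix w assume "w \<in> proj_point v"
    then obtain a where "w = a *s v" by (auto simp: proj_point_def)
    hence "w = f ((a / l) *s v)" using fa l0 by simp
    thus "w \<in> f ` proj_point v" by (auto simp: proj_point_def)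
  qed
  thus "elliptic f" using v by (auto simp: elliptic_def hyperbolic_plane_def)
qed

section \<open>Products of two reflections\<close>

text \<open>Conjugating a reflection by an isometry reflects in the image of its polar vector, and
  \<open>complex_reflection c\<close> is its own inverse. This turns $W_A$ into a product of two
  reflections.\<close>

lemma complex_reflection_reflect:
  assumes "hform b b = 1" and "hform c c = 1"
  shows "complex_reflection (complex_reflection c b) =
    complex_reflection c \<circ> complex_reflection b \<circ> complex_reflection c"
proof
  fix v
  have *: "hform (complex_reflection c b) (complex_reflection c b) = 1"
    using form_isometry_reflection[OF assms(2)] assms(1) by (simp add: form_isometry_def)
  show "complex_reflection (complex_reflection c b) v =
      (complex_reflection c \<circ> complex_reflection b \<circ> complex_reflection c) v"
    unfolding complex_reflection_def[of "complex_reflection c b"] *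
    by (simp add: complex_reflection_def hform_sesquilinear assms cnj_hform vec_eq_iff algebra_simps)
qed

text \<open>The vectors \<open>a\<close> and \<open>b\<close> span a positive definite plane, so its
  complement is negative: the norm of the cross product is minus the Gram determinant of
  \<open>a\<close> and \<open>b\<close>.\<close>

lemma orthogonal_negative_vector:
  assumes "hform a a = 1" and "hform b b = 1" and "cmod (hform a b) < 1"
  obtains v where "hnorm v < 0" and "hform v a = 0" and "hform v b = 0"
proof -
  \<comment> \<open>the Hermitian cross product of \<open>a\<close> and \<open>b\<close>\<close>
  define v :: "complex ^ 3" where "v = vector [cnj (a $ 2 * b $ 3 - a $ 3 * b $ 2),
     cnj (a $ 3 * b $ 1 - a $ 1 * b $ 3), - cnj (a $ 1 * b $ 2 - a $ 2 * b $ 1)]"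
  have "hform v v = hform a b * hform b a - hform a a * hform b b"
    by (simp add: v_def hform_def vector_3 algebra_simps)
  also have "\<dots> = complex_of_real ((cmod (hform a b))\<^sup>2 - 1)"
    using assms(1,2) by (metis complex_norm_square cnj_hform mult_1 of_real_1 of_real_diff)
  finally have "hnorm v = (cmod (hform a b))\<^sup>2 - 1" by (simp add: hnorm_def)
  moreover have "(cmod (hform a b))\<^sup>2 < 1" using assms(3) by (simp add: abs_square_less_1)
  moreover have "hform v a = 0" "hform v b = 0"
    by (simp_all add: v_def hform_def vector_3 algebra_simps)
  ultimately show ?thesis by (intro that[of v]) auto
qed

text \<open>The two complex geodesics meet inside the plane: each reflection negates a vector
  orthogonal to both polar vectors, so the product fixes it.\<close>

lemma elliptic_reflection_product:
  assumes "hform a a = 1" and "hform b b = 1" and "cmod (hform a b) < 1"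
  shows "elliptic (complex_reflection a \<circ> complex_reflection b)"
proof -
  obtain v where "hnorm v < 0" and v: "hform v a = 0" "hform v b = 0"
    using orthogonal_negative_vector[OF assms] .
  moreover have "(complex_reflection a \<circ> complex_reflection b) v = 1 *s v"
    by (simp add: complex_reflection_def hform_minus_left v)
  ultimately show ?thesis
    using elliptic_iff_eigenvector form_isometry_comp form_isometry_reflection assms(1,2)
    by (metis norm_one)
qed

text \<open>Otherwise \<open>a\<close> and \<open>b\<close> span an indefinite plane. A negative
  eigenvector turns out to be orthogonal to both, which would make that plane positive
  definite.\<close>

lemma cmod_hform_le_1_if_elliptic:
  assumes a: "hform a a = 1" and b: "hform b b = 1"
    and ell: "elliptic (complex_reflection a \<circ> complex_reflection b)"
  shows "cmod (hform a b) \<le> 1"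
proof (rule ccontr)
  assume "\<not> cmod (hform a b) \<le> 1"
  define z where "z = hform a b"
  have z: "cmod z > 1" "z \<noteq> 0" and ba: "hform b a = cnj z"
    using \<open>\<not> cmod (hform a b) \<le> 1\<close> by (auto simp: z_def cnj_hform)
  obtain v l where v: "hnorm v < 0" and l1: "cmod l = 1"
    and "complex_reflection a (complex_reflection b v) = l *s v"
    using ell elliptic_iff_eigenvector form_isometry_comp form_isometry_reflection a b
    by (metis comp_apply)
  \<comment> \<open>The involution \<open>complex_reflection a\<close> moves to the other side;
    pairing with \<open>a\<close> and \<open>b\<close> then gives two linear equations in
    \<open>\<alpha>\<close> and \<open>\<beta>\<close>.\<close>
  hence eq: "complex_reflection b v = l *s complex_reflection a v"
    using complex_reflection_involution[OF a] form_isometry_reflection[OF a]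
    by (metis form_isometry_def)
  define \<alpha> where "\<alpha> = hform v a"
  define \<beta> where "\<beta> = hform v b"
  from eq have e: "- v + (2 * \<beta>) *s b = l *s (- v + (2 * \<alpha>) *s a)"
    by (simp add: complex_reflection_def a b \<alpha>_def \<beta>_def)
  have e1: "2 * \<beta> * cnj z = (l + 1) * \<alpha>"
    using arg_cong[OF e, of "\<lambda>w. hform w a"]
    by (simp add: hform_sesquilinear a ba \<alpha>_def[symmetric] algebra_simps)
  have e2: "2 * l * \<alpha> * z = (l + 1) * \<beta>"
    using arg_cong[OF e, of "\<lambda>w. hform w b"]
    by (simp add: hform_sesquilinear b z_def[symmetric] \<beta>_def[symmetric] algebra_simps)
  have zz: "z * cnj z = complex_of_real ((cmod z)\<^sup>2)" by (metis complex_norm_square)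
  have zz1: "(cmod z)\<^sup>2 > 1" using z by (simp add: one_less_power)
  have ab: "(l + 1)\<^sup>2 * (\<alpha> * \<beta>) = 4 * l * (z * cnj z) * (\<alpha> * \<beta>)"
    using e1 e2 by (simp add: power2_eq_square) algebra
  \<comment> \<open>Otherwise $(l + 1)^2 = 4 l |z|^2$ has modulus greater than 4, although $|l + 1|
    \<le> 2$.\<close>
  have "\<alpha> * \<beta> = 0"
  proof (rule ccontr)
    assume "\<alpha> * \<beta> \<noteq> 0"
    hence "(l + 1)\<^sup>2 = 4 * l * (z * cnj z)" using ab by simp
    hence "(cmod (l + 1))\<^sup>2 = 4 * (cmod z)\<^sup>2"
      by (metis complex_mod_cnj l1 mult.right_neutral norm_mult norm_numeral norm_power power2_eq_square)
    moreover have "cmod (l + 1) \<le> 2" using l1 norm_triangle_ineq[of l 1] by simp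
    hence "(cmod (l + 1))\<^sup>2 \<le> 2\<^sup>2" by (intro power_mono) auto
    ultimately show False using zz1 by simp
  qed
  hence \<alpha>: "\<alpha> = 0" and \<beta>: "\<beta> = 0" using e1 e2 z l1 by auto
  \<comment> \<open>The component of \<open>a\<close> orthogonal to \<open>b\<close>, a negative
    vector of the plane.\<close>
  define w where "w = a - z *s b"
  have w: "hform w w = complex_of_real (1 - (cmod z)\<^sup>2)"
    by (simp add: w_def hform_sesquilinear a b ba z_def[symmetric] zz[unfolded of_real_power, symmetric] algebra_simps)
  have "hform v w = 0" using \<alpha> \<beta> by (simp add: w_def hform_sesquilinear \<alpha>_def \<beta>_def)
  hence "hform w v = 0" by (metis cnj_hform complex_cnj_zero)
  moreover have "w \<noteq> 0" using w zz1
    by (metis hform_scale_left diff_gt_0_iff_gt less_irrefl mult_zero_left of_real_eq_0_iff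
      vector_smult_lzero right_minus_eq)
  ultimately have "hnorm w > 0" using hnorm_pos_if_orthogonal_negative[OF v] by blast
  thus False using w zz1 by (simp add: hnorm_def)
qed

section \<open>Trace and ellipticity\<close>

text \<open>
  Goldman's discriminant $|\tau|^4 - 8 \mathrm{Re}\, \tau^3 + 18 |\tau|^2 - 27$, written so that
  the cusps $3 e^{\pm 2 \pi i / 3}$ of the deltoid become the cusp of $g^2 = 4 w^3$ at the origin.
\<close>

definition deltoid :: "complex \<Rightarrow> real" where
  "deltoid \<tau> = ((cmod \<tau>)\<^sup>2 + 12 * Re \<tau> + 9)\<^sup>2 - 4 * (2 * Re \<tau> + 3) ^ 3"

text \<open>One root \<open>x\<close> of the monic cubic comes from the fundamental theorem of
  algebra; the quadratic factor that is left splits by a complex square root.\<close>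

lemma cubic_roots:
  fixes A B C :: complex
  obtains x y z where "A = x + y + z" "B = x * y + x * z + y * z" "C = x * y * z"
proof -
  have "\<not> constant (poly [:- C, B, - A, 1:])"
    by (simp add: constant_degree)
  then obtain x where "poly [:- C, B, - A, 1:] x = 0"
    using fundamental_theorem_of_algebra by blast
  hence x: "x * (B - x * (A - x)) = C" by (simp add: algebra_simps)
  define s where "s = A - x"
  define d where "d = csqrt (s\<^sup>2 / 4 - (B - x * s))"
  have d: "d\<^sup>2 = s\<^sup>2 / 4 - (B - x * s)" by (simp add: d_def)
  have "(s / 2 + d) * (s / 2 - d) = s\<^sup>2 / 4 - d\<^sup>2" by (simp add: power2_eq_square algebra_simps)
  hence prod: "(s / 2 + d) * (s / 2 - d) = B - x * s" by (simp add: d)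
  show ?thesis
  proof
    show "A = x + (s / 2 + d) + (s / 2 - d)" by (simp add: s_def)
    have "x * (s / 2 + d) + x * (s / 2 - d) = x * s" by (simp add: algebra_simps)
    thus "B = x * (s / 2 + d) + x * (s / 2 - d) + (s / 2 + d) * (s / 2 - d)"
      by (simp add: prod)
    show "C = x * (s / 2 + d) * (s / 2 - d)"
      unfolding mult.assoc prod using x by (simp add: s_def)
  qed
qed

text \<open>Vieta's relations for \<open>l ^ 3 - \<tau> * l\<^sup>2 + cnj \<tau> * l - 1\<close>,
  the characteristic polynomial of an element of $SU(2,1)$ with trace \<open>\<tau>\<close>.\<close>

definition char_roots :: "complex \<Rightarrow> complex \<Rightarrow> complex \<Rightarrow> complex \<Rightarrow> bool" where
  "char_roots \<tau> x y z \<longleftrightarrow>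
     \<tau> = x + y + z \<and> cnj \<tau> = x * y + x * z + y * z \<and> x * y * z = 1"

lemma char_roots_root:
  assumes "char_roots \<tau> x y z"
  shows "l ^ 3 - \<tau> * l\<^sup>2 + cnj \<tau> * l - 1 = (l - x) * (l - y) * (l - z)"
  using assms unfolding char_roots_def by algebra

text \<open>Written in \<open>\<tau>\<close> and \<open>cnj \<tau>\<close>, Goldman's function is
  the discriminant of the characteristic polynomial.\<close>

lemma deltoid_eq_discriminant:
  assumes "char_roots \<tau> x y z"
  shows "complex_of_real (deltoid \<tau>) = ((x - y) * (x - z) * (y - z))\<^sup>2"
proof -
  have N: "complex_of_real ((cmod \<tau>)\<^sup>2) = \<tau> * cnj \<tau>" by (metis complex_norm_square)
  have Re: "complex_of_real (2 * Re \<tau>) = \<tau> + cnj \<tau>" by (simp add: complex_add_cnj)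
  have "complex_of_real (deltoid \<tau>) =
      (complex_of_real ((cmod \<tau>)\<^sup>2) + 6 * complex_of_real (2 * Re \<tau>) + 9)\<^sup>2
      - 4 * (complex_of_real (2 * Re \<tau>) + 3) ^ 3"
    by (simp add: deltoid_def)
  also have "\<dots> = (\<tau> * cnj \<tau> + 6 * (\<tau> + cnj \<tau>) + 9)\<^sup>2 - 4 * (\<tau> + cnj \<tau> + 3) ^ 3"
    unfolding N Re ..
  also have "\<dots> = \<tau>\<^sup>2 * (cnj \<tau>)\<^sup>2 - 4 * (cnj \<tau>) ^ 3 - 4 * \<tau> ^ 3 + 18 * \<tau> * cnj \<tau> - 27"
    by (simp add: power2_eq_square power3_eq_cube algebra_simps)
  also have "\<dots> = ((x - y) * (x - z) * (y - z))\<^sup>2"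
    using assms unfolding char_roots_def by algebra
  finally show ?thesis .
qed

text \<open>Conjugation inverts each root, hence sends \<open>D\<close> to $-D / (xyz)^2 = -D$; so
  \<open>D\<close> is imaginary.\<close>

lemma deltoid_nonpos_if_unit_roots:
  assumes roots: "char_roots \<tau> x y z" and "cmod x = 1" "cmod y = 1" "cmod z = 1"
  shows "deltoid \<tau> \<le> 0"
proof -
  define D where "D = (x - y) * (x - z) * (y - z)"
  have "x * cnj x = 1" "y * cnj y = 1" "z * cnj z = 1" "x * y * z = 1"
    using assms by (auto simp: cmod_eq_1_iff char_roots_def)
  hence "cnj D = - D" unfolding D_def complex_cnj_mult complex_cnj_diff by algebra
  hence "Re D = 0" by (simp add: complex_eq_iff)
  hence "Re (D\<^sup>2) \<le> 0" by (simp add: power2_eq_square)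
  thus ?thesis using deltoid_eq_discriminant[OF roots] D_def by (metis Re_complex_of_real)
qed

text \<open>Inversion in the unit circle swaps \<open>x\<close> and \<open>y\<close> and, since the
  product is 1, fixes \<open>z\<close>; this makes \<open>D\<close> real.\<close>

lemma deltoid_nonneg_if_reflected_root:
  assumes roots: "char_roots \<tau> x y z" and "y * cnj x = 1"
  shows "deltoid \<tau> \<ge> 0"
proof -
  define D where "D = (x - y) * (x - z) * (y - z)"
  have "y * cnj x = 1" "x * y * z = 1" using assms by (auto simp: char_roots_def)
  moreover from this have "x * cnj y = 1" "cnj x * cnj y * cnj z = 1"
    by (metis complex_cnj_cnj complex_cnj_mult complex_cnj_one mult.commute)+
  ultimately have "cnj D = D" unfolding D_def complex_cnj_mult complex_cnj_diff by algebra
  hence "Im D = 0" by (simp add: complex_eq_iff)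
  hence "Re (D\<^sup>2) \<ge> 0" by (simp add: power2_eq_square)
  thus ?thesis using deltoid_eq_discriminant[OF roots] D_def by (metis Re_complex_of_real)
qed

lemma unit_roots_if_deltoid_neg:
  assumes roots: "char_roots \<tau> x y z" and neg: "deltoid \<tau> < 0"
  shows "cmod x = 1"
proof -
  have roots': "char_roots \<tau> x z y" using roots by (auto simp: char_roots_def algebra_simps)
  have x0: "x \<noteq> 0" using roots by (auto simp: char_roots_def)
  \<comment> \<open>the set of roots is invariant under inversion in the unit circle\<close>
  define l where "l = 1 / cnj x"
  have lx: "l * cnj x = 1" using x0 by (simp add: l_def)
  have "x ^ 3 - \<tau> * x\<^sup>2 + cnj \<tau> * x - 1 = 0" using char_roots_root[OF roots, of x] by simp
  hence "cnj (x ^ 3 - \<tau> * x\<^sup>2 + cnj \<tau> * x - 1) = 0" by simp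
  hence "(cnj x) ^ 3 - cnj \<tau> * (cnj x)\<^sup>2 + \<tau> * cnj x - 1 = 0" by simp
  hence "l ^ 3 - \<tau> * l\<^sup>2 + cnj \<tau> * l - 1 = 0" using lx by algebra
  hence "l = x \<or> l = y \<or> l = z" using char_roots_root[OF roots, of l] by auto
  moreover have "l \<noteq> y" using deltoid_nonneg_if_reflected_root[OF roots] neg lx by force
  moreover have "l \<noteq> z" using deltoid_nonneg_if_reflected_root[OF roots'] neg lx by force
  ultimately have "x * cnj x = 1" using lx by simp
  thus ?thesis by (simp add: cmod_eq_1_iff)
qed

section \<open>From eigenvalues to ellipticity\<close>

lemma orthogonal_eigenvectors:
  assumes f: "form_isometry f" and u: "f u = l *s u" and v: "f v = m *s v"
    and unit: "cmod m = 1" and lm: "l \<noteq> m"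
  shows "hform u v = 0"
proof -
  have "hform u v = l * cnj m * hform u v"
    using f u v unfolding form_isometry_def
    by (metis hform_scale_left hform_scale_right mult.assoc mult.left_commute)
  hence "hform u v * (l * cnj m - 1) = 0" by (simp add: algebra_simps)
  moreover have "l * cnj m \<noteq> 1"
  proof
    assume "l * cnj m = 1"
    moreover have "m * cnj m = 1" using unit by (simp add: cmod_eq_1_iff)
    ultimately have "l = m" by algebra
    with lm show False ..
  qed
  ultimately show ?thesis by simp
qed

text \<open>The eigenvectors form an orthogonal basis, which has to contain a negative vector.\<close>

lemma elliptic_if_distinct_unit_eigenvalues:
  assumes f: "form_isometry f"
    and eig: "f u = x *s u" "f v = y *s v" "f w = z *s w"
    and nz: "u \<noteq> 0" "v \<noteq> 0" "w \<noteq> 0"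
    and unit: "cmod x = 1" "cmod y = 1" "cmod z = 1"
    and distinct: "x \<noteq> y" "x \<noteq> z" "y \<noteq> z"
  shows "elliptic f"
proof (rule ccontr)
  assume "\<not> elliptic f"
  hence nonneg: "hnorm u \<ge> 0" "hnorm v \<ge> 0" "hnorm w \<ge> 0"
    using eig unit elliptic_iff_eigenvector[OF f] by (meson not_le)+
  have orth: "hform u v = 0" "hform v u = 0" "hform u w = 0" "hform w u = 0" "hform v w = 0" "hform w v = 0"
    using orthogonal_eigenvectors[OF f] eig unit distinct by metis+
  define M :: "complex ^ 3 ^ 3" where "M = (\<chi> i j. if j = 1 then u $ i else if j = 2 then v $ i else w $ i)"
  have M: "M *v p = (p $ 1) *s u + (p $ 2) *s v + (p $ 3) *s w" for p
    by (simp add: M_def vec_eq_iff matrix_vector_mult_def sum_3 algebra_simps)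
  have "p = 0" if "M *v p = 0" for p
  proof -
    define X where "X = (p $ 1) *s u"
    define Y where "Y = (p $ 2) *s v"
    define Z where "Z = (p $ 3) *s w"
    have fX: "f X = x *s X" "f Y = y *s Y" "f Z = z *s Z"
      using f eig by (simp_all add: X_def Y_def Z_def form_isometry_def mult.commute)
    have f0: "f 0 = 0" using f by (metis form_isometry_def vector_smult_lzero)
    \<comment> \<open>Applying \<open>f\<close> twice to this relation gives a Vandermonde system,
      which is regular because the eigenvalues are distinct.\<close>
    have 0: "X + Y + Z = 0" using that M by (simp add: X_def Y_def Z_def)
    have 1: "x *s X + y *s Y + z *s Z = 0"
      using f0 f unfolding 0[symmetric] by (simp add: form_isometry_def fX)
    have 2: "x *s (x *s X) + y *s (y *s Y) + z *s (z *s Z) = 0"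
      using f0 f unfolding 1[symmetric] by (simp add: form_isometry_def fX)
    have "X $ i = 0 \<and> Y $ i = 0 \<and> Z $ i = 0" for i
    proof -
      have e: "X $ i + Y $ i + Z $ i = 0" "x * X $ i + y * Y $ i + z * Z $ i = 0"
        "x * (x * X $ i) + y * (y * Y $ i) + z * (z * Z $ i) = 0"
        using arg_cong[OF 0, of "\<lambda>w. w $ i"] arg_cong[OF 1, of "\<lambda>w. w $ i"]
          arg_cong[OF 2, of "\<lambda>w. w $ i"] by (simp_all add: mult.assoc)
      have "(x - y) * (x - z) * X $ i = 0" using e by algebra
      moreover have "(y - x) * (y - z) * Y $ i = 0" using e by algebra
      moreover have "(z - x) * (z - y) * Z $ i = 0" using e by algebra
      ultimately show ?thesis using distinct by simp
    qed
    hence "X = 0" "Y = 0" "Z = 0" by (simp_all add: vec_eq_iff)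
    thus "p = 0" using nz by (simp add: X_def Y_def Z_def vec3_eq_0[of p] vector_mul_eq_0)
  qed
  hence "\<exists>B. B ** M = mat 1" by (simp add: matrix_left_invertible_ker)
  then obtain B where MB: "M ** B = mat 1" using matrix_left_right_inverse by blast
  \<comment> \<open>A negative vector; expanding its norm in the orthogonal eigenbasis gives a
    nonnegative number.\<close>
  define e :: "complex ^ 3" where "e = axis 3 1"
  hence "M *v (B *v e) = e" by (simp add: matrix_vector_mul_assoc MB)
  then obtain p :: "complex ^ 3" where p: "(p $ 1) *s u + (p $ 2) *s v + (p $ 3) *s w = e"
    using M by metis
  have "complex_of_real (hnorm e) =
      hform ((p $ 1) *s u + (p $ 2) *s v + (p $ 3) *s w) ((p $ 1) *s u + (p $ 2) *s v + (p $ 3) *s w)"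
    unfolding p hform_self ..
  also have "\<dots> = complex_of_real ((cmod (p $ 1))\<^sup>2 * hnorm u + (cmod (p $ 2))\<^sup>2 * hnorm v
      + (cmod (p $ 3))\<^sup>2 * hnorm w)"
    by (simp only: of_real_add of_real_mult complex_norm_square hform_sesquilinear orth hform_self[symmetric])
       (simp add: algebra_simps)
  finally have "hnorm e = (cmod (p $ 1))\<^sup>2 * hnorm u + (cmod (p $ 2))\<^sup>2 * hnorm v
      + (cmod (p $ 3))\<^sup>2 * hnorm w" using of_real_eq_iff by blast
  also have "\<dots> \<ge> 0" using nonneg by simp
  finally show False by (simp add: hnorm_eq e_def axis_def)
qed

text \<open>For \<open>l\<close> different from \<open>m\<close>, the vector \<open>u\<close> is
  orthogonal to \<open>v\<close> and therefore positive; preserving its nonzero norm puts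
  \<open>l\<close> on the unit circle.\<close>

lemma unit_eigenvalue_if_negative_eigenvector:
  assumes f: "form_isometry f" and v: "hnorm v < 0" "f v = m *s v" "cmod m = 1"
    and u: "u \<noteq> 0" "f u = l *s u"
  shows "cmod l = 1"
proof (cases "l = m")
  case False
  hence "hform u v = 0" using orthogonal_eigenvectors f u v by blast
  hence "hnorm u > 0" using hnorm_pos_if_orthogonal_negative v u by blast
  hence "hform u u \<noteq> 0" by (simp add: hform_self)
  moreover have "hform u u = l * cnj l * hform u u"
    using f u unfolding form_isometry_def
    by (metis hform_scale_left hform_scale_right mult.assoc)
  ultimately have "l * cnj l = 1" by simp
  thus ?thesis by (simp add: cmod_eq_1_iff)
qed (use v in simp)

text \<open>Through \<open>eig\<close> the cubic acts as the characteristic polynomial of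
  \<open>f\<close>. On the curve \<open>deltoid \<tau> = 0\<close> eigenvalues coincide and the
  trace alone does not decide ellipticity, hence two one-sided implications.\<close>

lemma elliptic_and_deltoid:
  assumes f: "form_isometry f"
    and eig: "\<And>l. l ^ 3 - \<tau> * l\<^sup>2 + cnj \<tau> * l - 1 = 0 \<Longrightarrow> \<exists>v. v \<noteq> 0 \<and> f v = l *s v"
  shows "elliptic f \<Longrightarrow> deltoid \<tau> \<le> 0" and "deltoid \<tau> < 0 \<Longrightarrow> elliptic f"
proof -
  obtain x y z where "\<tau> = x + y + z" "cnj \<tau> = x * y + x * z + y * z" "1 = x * y * z"
    by (rule cubic_roots)
  hence roots: "char_roots \<tau> x y z" "char_roots \<tau> y x z" "char_roots \<tau> z x y"
    by (auto simp: char_roots_def algebra_simps)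
  obtain u v w where uvw: "u \<noteq> 0" "f u = x *s u" "v \<noteq> 0" "f v = y *s v" "w \<noteq> 0" "f w = z *s w"
    using eig char_roots_root[OF roots(1)] by (metis eq_iff_diff_eq_0 mult_zero_left mult_zero_right)
  show "deltoid \<tau> \<le> 0" if "elliptic f"
  proof -
    from that obtain n m where "hnorm n < 0" "f n = m *s n" "cmod m = 1"
      using elliptic_iff_eigenvector[OF f] by blast
    hence "cmod x = 1" "cmod y = 1" "cmod z = 1"
      using unit_eigenvalue_if_negative_eigenvector[OF f] uvw by blast+
    thus ?thesis using deltoid_nonpos_if_unit_roots roots(1) by blast
  qed
  show "elliptic f" if "deltoid \<tau> < 0"
  proof -
    have "cmod x = 1" "cmod y = 1" "cmod z = 1"
      using unit_roots_if_deltoid_neg that roots by blast+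
    moreover have "((x - y) * (x - z) * (y - z))\<^sup>2 \<noteq> 0"
      using that unfolding deltoid_eq_discriminant[OF roots(1), symmetric] by simp
    hence "x \<noteq> y" "x \<noteq> z" "y \<noteq> z" by auto
    ultimately show ?thesis using elliptic_if_distinct_unit_eigenvalues f uvw by blast
  qed
qed

section \<open>The cuspidal region\<close>

text \<open>
  With \<open>Rk\<close> the square of $r_k$, \<open>cusp_height\<close> is the value of $w$ at the parameter $t_A$ at which
  $W_A$ becomes elliptic, and \<open>cusp_gap\<close> is $g$ as an affine function of $w$.
\<close>

definition cusp_height :: "real \<Rightarrow> real \<Rightarrow> real \<Rightarrow> real" where
  "cusp_height R1 R2 R3 = 1 + 4 * (2 * R1 - 1) * (2 * R2 - 1) - 4 * R3"

definition cusp_gap :: "real \<Rightarrow> real \<Rightarrow> real \<Rightarrow> real \<Rightarrow> real" where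
  "cusp_gap R1 R2 R3 w =
     64 * R1 * R2 * R3 - (3 - 4 * (R1 + R2 + R3))\<^sup>2 - 3 * (3 - 4 * (R1 + R2 + R3)) - 9
     + (9 - 4 * (R1 + R2 + R3)) * w"

text \<open>The height decreases in \<open>R3\<close>, so \<open>R3 = R2\<close> is the extreme
  case. There it is affine in \<open>y\<close>, and its values at \<open>y = 0\<close> and
  \<open>y = x\<close> are both negative for $1/8 < x \<le> 1/2$.\<close>

lemma cusp_height_nonneg_imp:
  assumes "1/2 \<le> R1" "R1 \<le> R2" "R2 \<le> R3" "R3 \<le> 1" "0 \<le> cusp_height R1 R2 R3"
  shows "7/8 \<le> R1"
proof (rule ccontr)
  assume "\<not> 7/8 \<le> R1"
  define x where "x = 1 - R1"
  define y where "y = 1 - R2"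
  have xy: "1/8 < x" "x \<le> 1/2" "y \<le> x" "0 \<le> y"
    using assms \<open>\<not> 7/8 \<le> R1\<close> by (auto simp: x_def y_def)
  have "0 \<le> cusp_height R1 R2 R2" using assms by (simp add: cusp_height_def)
  also have "cusp_height R1 R2 R2 = 1 - 8 * x - 4 * y * (1 - 4 * x)"
    by (simp add: cusp_height_def x_def y_def algebra_simps)
  finally have *: "0 \<le> 1 - 8 * x - 4 * y * (1 - 4 * x)" .
  show False
  proof (cases "x \<le> 1/4")
    case True
    hence "0 \<le> 4 * y * (1 - 4 * x)" using xy by simp
    thus False using * xy by simp
  next
    case False
    have "y * (4 * x - 1) \<le> x * (4 * x - 1)" using False xy by (intro mult_right_mono) auto
    moreover have "(x - 1/4) * (x - 1/2) \<le> 0" using False xy by (simp add: mult_nonneg_nonpos)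
    ultimately show False using * False xy by (simp add: algebra_simps power2_eq_square)
  qed
qed

text \<open>The line passes above the cusp. Only the term \<open>z * q\<close> contains
  \<open>z\<close>; raising \<open>z\<close> to \<open>y\<close> there leaves
  \<open>(1 - 4 * x) ^ 3\<close> plus a nonnegative multiple of \<open>x - y\<close>.\<close>

lemma cusp_gap_0_pos:
  assumes "7/8 \<le> R1" "R1 \<le> R2" "R2 \<le> R3" "R3 \<le> 1" "0 \<le> cusp_height R1 R2 R3"
  shows "0 < cusp_gap R1 R2 R3 0"
proof -
  define x where "x = 1 - R1"
  define y where "y = 1 - R2"
  define z where "z = 1 - R3"
  have d: "0 \<le> z" "z \<le> y" "y \<le> x" "x \<le> 1/8"
    using assms by (auto simp: x_def y_def z_def)
  define q where "q = cusp_height R1 R2 R3"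
  have q: "q = 1 - 8 * x - 8 * y + 16 * x * y + 4 * z"
    by (simp add: q_def cusp_height_def x_def y_def z_def algebra_simps)
  have "cusp_gap R1 R2 R3 0 = 1 - 4 * (x + y) - 16 * (x - y)\<^sup>2 - 4 * (z * q)"
    unfolding q by (simp add: cusp_gap_def x_def y_def z_def power2_eq_square algebra_simps)
  moreover have "z * q \<le> y * (q + 4 * (y - z))"
    using d assms(5) by (intro mult_mono) (auto simp: q_def)
  moreover have "1 - 4 * (x + y) - 16 * (x - y)\<^sup>2 - 4 * (y * (q + 4 * (y - z))) =
      (1 - 4 * x) ^ 3 + (x - y) * (8 * (1 - 8 * x) + 64 * x * (x + y))"
    unfolding q by (simp add: power2_eq_square power3_eq_cube algebra_simps)
  moreover have "0 \<le> (x - y) * (8 * (1 - 8 * x) + 64 * x * (x + y))"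
    using d by (intro mult_nonneg_nonneg add_nonneg_nonneg) auto
  moreover have "0 < (1 - 4 * x) ^ 3" using d by simp
  ultimately show ?thesis by linarith
qed

lemma cusp_height_mono:
  assumes "7/8 \<le> R1'" "7/8 \<le> R2'" "R1' \<le> R1" "R2' \<le> R2" "R3 \<le> R3'"
    and "R1' < R1 \<or> R2' < R2 \<or> R3 < R3'"
  shows "cusp_height R1' R2' R3' < cusp_height R1 R2 R3"
proof -
  have "cusp_height R1 R2 R3 - cusp_height R1' R2' R3' =
      8 * (R1 - R1') * (2 * R2 - 1) + 8 * (R2 - R2') * (2 * R1' - 1) + 4 * (R3' - R3)"
    by (simp add: cusp_height_def algebra_simps)
  moreover have "0 \<le> 8 * (R1 - R1') * (2 * R2 - 1)" "0 \<le> 8 * (R2 - R2') * (2 * R1' - 1)"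
    using assms by simp_all
  moreover have "R1' < R1 \<Longrightarrow> 0 < 8 * (R1 - R1') * (2 * R2 - 1)"
    "R2' < R2 \<Longrightarrow> 0 < 8 * (R2 - R2') * (2 * R1' - 1)" using assms by simp_all
  ultimately show ?thesis using assms(5,6) by (smt (verit))
qed

lemma cusp_gap_mono_1:
  assumes "7/8 \<le> R1'" "7/8 \<le> R2" "R1' \<le> R1" "R1 \<le> 1" "R2 \<le> 1" "R3 \<le> 1"
  shows "cusp_gap R1 R2 R3 (cusp_height R1 R2 R3) \<le> cusp_gap R1' R2 R3 (cusp_height R1' R2 R3)"
proof -
  define x where "x = 1 - R1"
  define x' where "x' = 1 - R1'"
  define y where "y = 1 - R2"
  define z where "z = 1 - R3"
  have d: "0 \<le> z" "0 \<le> y" "y \<le> 1/8" "0 \<le> x" "x \<le> x'" "x' \<le> 1/8"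
    using assms by (auto simp: x_def y_def z_def x'_def)
  have "cusp_gap R1' R2 R3 (cusp_height R1' R2 R3) - cusp_gap R1 R2 R3 (cusp_height R1 R2 R3)
     = (x' - x) * (24 - 48 * (x + x') - 80 * y + (16 * z + 64 * (x + x') * y + 64 * y\<^sup>2))"
    by (simp add: cusp_gap_def cusp_height_def x_def y_def z_def x'_def power2_eq_square algebra_simps)
  \<comment> \<open>As \<open>x + x' \<le> 1/4\<close> and \<open>y \<le> 1/8\<close>, the second
    factor is at least 24 - 12 - 10 = 2.\<close>
  also have "\<dots> \<ge> 0" using d by (intro mult_nonneg_nonneg add_nonneg_nonneg) auto
  finally show ?thesis by simp
qed

text \<open>One variable is moved at a time: \<open>R3\<close>, then \<open>R1\<close>, then
  \<open>R2\<close> by symmetry in the first two arguments. In \<open>R3\<close> the value is affine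
  with slope at least 12 - 4 = 8.\<close>

lemma cusp_gap_mono:
  assumes "7/8 \<le> R1'" "7/8 \<le> R2'" "7/8 \<le> R3" "R1' \<le> R1" "R2' \<le> R2" "R3 \<le> R3'"
    "R1 \<le> 1" "R2 \<le> 1" "R3' \<le> 1"
  shows "cusp_gap R1 R2 R3 (cusp_height R1 R2 R3) \<le> cusp_gap R1' R2' R3' (cusp_height R1' R2' R3')"
proof -
  have swap: "cusp_gap b a c (cusp_height b a c) = cusp_gap a b c (cusp_height a b c)" for a b c
    by (simp add: cusp_gap_def cusp_height_def algebra_simps)
  have "cusp_gap R1 R2 R3' (cusp_height R1 R2 R3') - cusp_gap R1 R2 R3 (cusp_height R1 R2 R3)
      = (R3' - R3) * (12 - 16 * ((1 - R1) + (1 - R2)))"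
    by (simp add: cusp_gap_def cusp_height_def power2_eq_square algebra_simps)
  also have "\<dots> \<ge> 0" using assms by simp
  finally have "cusp_gap R1 R2 R3 (cusp_height R1 R2 R3) \<le> cusp_gap R1 R2 R3' (cusp_height R1 R2 R3')"
    by simp
  also have "\<dots> \<le> cusp_gap R1' R2 R3' (cusp_height R1' R2 R3')"
    using assms by (intro cusp_gap_mono_1) auto
  also have "\<dots> \<le> cusp_gap R1' R2' R3' (cusp_height R1' R2' R3')"
    unfolding swap[of R1'] using assms by (intro cusp_gap_mono_1) auto
  finally show ?thesis .
qed

text \<open>The point $(w, g)$ at $t_A$ lies on or to the left of the axis $w = 0$, or strictly
  above the upper branch of $g^2 = 4 w^3$.\<close>

definition passes_cusp :: "real \<Rightarrow> real \<Rightarrow> real \<Rightarrow> bool" where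
  "passes_cusp R1 R2 R3 \<longleftrightarrow> cusp_height R1 R2 R3 \<le> 0 \<or>
     0 < cusp_gap R1 R2 R3 (cusp_height R1 R2 R3) \<and>
     4 * cusp_height R1 R2 R3 ^ 3 < (cusp_gap R1 R2 R3 (cusp_height R1 R2 R3))\<^sup>2"

text \<open>The unprimed values satisfy only weak inequalities, because ellipticity on the boundary
  curve is undecided. A strict change in one variable gives \<open>q' < q\<close>, while
  \<open>h \<le> h'\<close>, and so the conclusion is strict.\<close>

lemma passes_cusp_mono:
  assumes "1/2 \<le> R1' \<or> cusp_height R1' R2' R3' \<le> 0" "R1' \<le> R2'" "R2' \<le> R3'" "R3' \<le> 1"
    and "R1 \<le> R2" "R2 \<le> R3"
    and "R1' \<le> R1" "R2' \<le> R2" "R3 \<le> R3'" "R1' < R1 \<or> R2' < R2 \<or> R3 < R3'"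
    and "0 < cusp_height R1 R2 R3 \<Longrightarrow> 0 \<le> cusp_gap R1 R2 R3 (cusp_height R1 R2 R3) \<and>
     4 * cusp_height R1 R2 R3 ^ 3 \<le> (cusp_gap R1 R2 R3 (cusp_height R1 R2 R3))\<^sup>2"
  shows "passes_cusp R1' R2' R3'"
proof (cases "cusp_height R1' R2' R3' \<le> 0")
  case True
  thus ?thesis by (simp add: passes_cusp_def)
next
  case False
  have R1': "7/8 \<le> R1'" using cusp_height_nonneg_imp[of R1' R2' R3'] assms False by auto
  define q where "q = cusp_height R1 R2 R3"
  define q' where "q' = cusp_height R1' R2' R3'"
  define h where "h = cusp_gap R1 R2 R3 q"
  define h' where "h' = cusp_gap R1' R2' R3' q'"
  have q: "q' < q" unfolding q_def q'_def using assms R1' by (intro cusp_height_mono) auto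
  have "h \<le> h'" unfolding q_def q'_def h_def h'_def using assms R1' by (intro cusp_gap_mono) auto
  have q': "0 < q'" using False q'_def by simp
  have h: "0 \<le> h" "4 * q ^ 3 \<le> h\<^sup>2" using assms(11) q q' by (auto simp: q_def h_def)
  have "4 * q' ^ 3 < 4 * q ^ 3" using q q' by (simp add: power_strict_mono)
  also have "\<dots> \<le> h\<^sup>2" by (rule h)
  also have "\<dots> \<le> h'\<^sup>2" using \<open>h \<le> h'\<close> h by (intro power_mono) auto
  finally have "4 * q' ^ 3 < h'\<^sup>2" .
  moreover have "0 < 4 * q' ^ 3" using q' by simp
  ultimately have "h' \<noteq> 0" by auto
  thus ?thesis using \<open>4 * q' ^ 3 < h'\<^sup>2\<close> \<open>h \<le> h'\<close> h
    unfolding passes_cusp_def q'_def[symmetric] h'_def[symmetric] by auto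
qed

text \<open>For negative \<open>w\<close> the cube is negative, and at the cusp the gap must merely
  not vanish. For positive \<open>w\<close> the slope of the gap is at most 9 - 21/2, so moving left
  from the height raises the gap and lowers the cube.\<close>

lemma passes_cusp_disc_pos:
  assumes "passes_cusp R1 R2 R3"
    and R: "R1 \<le> R2" "R2 \<le> R3" "R3 \<le> 1"
    and cases: "1/2 \<le> R1 \<or> R1 = 1/4 \<and> 1/4 \<le> R2 \<and> 1/2 \<le> R3"
    and w: "w \<le> cusp_height R1 R2 R3"
  shows "4 * w ^ 3 < (cusp_gap R1 R2 R3 w)\<^sup>2"
proof -
  define q where "q = cusp_height R1 R2 R3"
  consider "w < 0" | "w = 0" | "0 < w" by linarith
  thus ?thesis
  proof cases
    case 1
    hence "4 * w ^ 3 < 0" by (simp add: power_less_zero_eq)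
    thus ?thesis by (rule less_le_trans) simp
  next
    case 2
    hence q: "0 \<le> q" using w q_def by simp
    have "cusp_gap R1 R2 R3 0 \<noteq> 0" using cases
    proof
      assume "1/2 \<le> R1"
      hence "7/8 \<le> R1" using cusp_height_nonneg_imp R q q_def by blast
      thus ?thesis using cusp_gap_0_pos R q q_def by (metis less_irrefl)
    next
      assume *: "R1 = 1/4 \<and> 1/4 \<le> R2 \<and> 1/2 \<le> R3"
      hence R1: "R1 = 1/4" by simp
      \<comment> \<open>This leaves only the values of the triple (3,3,4), for which the gap at 0 is
        -5.\<close>
      have "R2 + R3 \<le> 3/4" using q unfolding q_def cusp_height_def R1 by simp
      hence R23: "R2 = 1/4" "R3 = 1/2" using * by auto
      show ?thesis unfolding cusp_gap_def R1 R23 by (simp add: power2_eq_square)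
    qed
    thus ?thesis using 2 by simp
  next
    case 3
    hence q: "0 < q" "w \<le> q" using w q_def by auto
    have "1/2 \<le> R1"
    proof (rule ccontr)
      assume "\<not> 1/2 \<le> R1"
      hence R1: "R1 = 1/4" and R23: "1/4 \<le> R2" "1/2 \<le> R3" using cases by auto
      thus False using q(1) unfolding q_def cusp_height_def R1 by simp
    qed
    hence "7/8 \<le> R1" using cusp_height_nonneg_imp R q q_def by auto
    hence "(9 - 4 * (R1 + R2 + R3)) * (q - w) \<le> 0" using R q by (simp add: mult_nonpos_nonneg)
    hence "cusp_gap R1 R2 R3 q \<le> cusp_gap R1 R2 R3 w" by (simp add: cusp_gap_def algebra_simps)
    moreover have "0 < cusp_gap R1 R2 R3 q" "4 * q ^ 3 < (cusp_gap R1 R2 R3 q)\<^sup>2"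
      using assms(1) q by (auto simp: passes_cusp_def q_def)
    moreover have "w ^ 3 \<le> q ^ 3" using 3 q by (intro power_mono) auto
    ultimately show ?thesis
      by (smt (verit) power_mono)
  qed
qed

text \<open>The gap is affine in \<open>w\<close> and positive at 0. A zero with
  \<open>w > 0\<close> lies inside the cuspidal region, so $W_B$ is already elliptic there.\<close>

lemma cusp_gap_zero_between:
  assumes R: "7/8 \<le> R1" "R1 \<le> R2" "R2 \<le> R3" "R3 \<le> 1" and q: "0 < cusp_height R1 R2 R3"
    and h: "cusp_gap R1 R2 R3 (cusp_height R1 R2 R3) < 0"
  obtains w where "0 < w" "w < cusp_height R1 R2 R3" "cusp_gap R1 R2 R3 w = 0"
proof -
  define q where "q = cusp_height R1 R2 R3"
  define k where "k = cusp_gap R1 R2 R3 0"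
  define b where "b = 9 - 4 * (R1 + R2 + R3)"
  have gap: "cusp_gap R1 R2 R3 w = k + b * w" for w by (simp add: cusp_gap_def k_def b_def)
  have k: "0 < k" unfolding k_def using R q by (intro cusp_gap_0_pos) auto
  have b: "b < 0" using R by (simp add: b_def)
  have "0 < - k / b" using k b by (simp add: divide_pos_neg)
  moreover have "- k / b < q" using h b unfolding gap q_def[symmetric] by (simp add: field_simps)
  moreover have "cusp_gap R1 R2 R3 (- k / b) = 0" using b by (simp add: gap)
  ultimately show ?thesis using that q_def by blast
qed

section \<open>The Gram matrix of a triangle\<close>

text \<open>Pairing the relation with \<open>a\<close>, \<open>b\<close>, \<open>c\<close> gives a
  homogeneous system whose determinant \<open>D\<close> is the Gram determinant.\<close>

lemma gram_independent:
  assumes unit: "hform a a = 1" "hform b b = 1" "hform c c = 1"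
    and det: "1 + hform b a * hform c b * hform a c + hform c a * hform a b * hform b c
      - hform b c * hform c b - hform b a * hform a b - hform c a * hform a c \<noteq> 0"
    and zero: "x *s a + y *s b + z *s c = 0"
  shows "x = 0 \<and> y = 0 \<and> z = 0"
proof -
  have e: "x + y * hform b a + z * hform c a = 0" "x * hform a b + y + z * hform c b = 0"
    "x * hform a c + y * hform b c + z = 0"
    using arg_cong[OF zero, of "\<lambda>w. hform w a"] arg_cong[OF zero, of "\<lambda>w. hform w b"]
      arg_cong[OF zero, of "\<lambda>w. hform w c"]
    by (simp_all add: hform_sesquilinear unit hform_def[of 0])
  define D where "D = 1 + hform b a * hform c b * hform a c + hform c a * hform a b * hform b c
      - hform b c * hform c b - hform b a * hform a b - hform c a * hform a c"
  have "D * x = 0" "D * y = 0" "D * z = 0" using e unfolding D_def by algebra+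
  thus ?thesis using det D_def by simp
qed

lemma reflection_word_eigenvector:
  assumes unit: "hform a a = 1" "hform b b = 1" "hform c c = 1"
    and det: "1 + hform b a * hform c b * hform a c + hform c a * hform a b * hform b c
      - hform b c * hform c b - hform b a * hform a b - hform c a * hform a c \<noteq> 0"
    and \<tau>: "\<tau> = 3 - 4 * (hform b c * hform c b + hform a c * hform c a + hform a b * hform b a)
       + 8 * (hform c b * hform a c * hform b a)"
    and l: "l ^ 3 - \<tau> * l\<^sup>2 + cnj \<tau> * l - 1 = 0"
  shows "\<exists>v. v \<noteq> 0 \<and>
    (complex_reflection a \<circ> complex_reflection b \<circ> complex_reflection c) v = l *s v"
proof -
  \<comment> \<open>The kernel of \<open>M\<close> consists of the coordinates, with respect to \<open>a\<close>, \<open>b\<close>, \<open>c\<close>, of the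
    eigenvectors of the word for the eigenvalue \<open>l\<close>.\<close>
  define M :: "complex ^ 3 ^ 3" where "M = vector [
     vector [l - 1, 2 * l * hform b a, 2 * l * hform c a],
     vector [2 * hform a b, 1 - l, - 2 * l * hform c b],
     vector [2 * hform a c, 2 * hform b c, 1 - l]]"
  have ct: "cnj \<tau> = 3 - 4 * (hform b c * hform c b + hform a c * hform c a + hform a b * hform b a)
       + 8 * (hform b c * hform c a * hform a b)"
    by (simp add: \<tau> cnj_hform algebra_simps)
  have "det M = l ^ 3 - \<tau> * l\<^sup>2 + cnj \<tau> * l - 1"
    unfolding ct unfolding \<tau>
    by (simp add: det_3 M_def vector_3 power2_eq_square power3_eq_cube algebra_simps)
  hence "\<not> (\<exists>B. B ** M = mat 1)" using l by (metis invertible_det_nz invertible_left_inverse)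
  then obtain p where "M *v p = 0" and p: "p \<noteq> 0" by (auto simp: matrix_left_invertible_ker)
  define x y z where "x = p $ 1" and "y = p $ 2" and "z = p $ 3"
  have nz: "x \<noteq> 0 \<or> y \<noteq> 0 \<or> z \<noteq> 0" using p by (auto simp: vec3_eq_0 x_def y_def z_def)
  have e: "(l - 1) * x + 2 * l * hform b a * y + 2 * l * hform c a * z = 0"
    "2 * hform a b * x + (1 - l) * y - 2 * l * hform c b * z = 0"
    "2 * hform a c * x + 2 * hform b c * y + (1 - l) * z = 0"
    using \<open>M *v p = 0\<close>
    by (simp_all add: M_def vec3_eq_0 matrix_vector_mult_def sum_3 vector_3 x_def y_def z_def)
  define v where "v = x *s a + y *s b + z *s c"
  have "v \<noteq> 0" unfolding v_def using gram_independent[OF unit det] nz by blast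
  moreover
  \<comment> \<open>The kernel equations say that the three reflections add
    \<open>(1 + l) * z\<close>, \<open>- (1 + l) * y\<close> and \<open>(1 + l) * x\<close> times
    their polar vectors; with the alternating signs the result is
    \<open>- v + (1 + l) *s v\<close>.\<close>
  have "2 * hform v c = (1 + l) * z"
    using e(3) unfolding v_def hform_sesquilinear unit by algebra
  hence 1: "complex_reflection c v = - v + ((1 + l) * z) *s c"
    by (simp add: complex_reflection_def unit)
  have "2 * hform (- v + ((1 + l) * z) *s c) b = - (1 + l) * y"
    using e(2) unfolding v_def hform_sesquilinear unit by algebra
  hence 2: "complex_reflection b (- v + ((1 + l) * z) *s c) =
     - (- v + ((1 + l) * z) *s c) + (- (1 + l) * y) *s b"
    by (simp add: complex_reflection_def unit)
  have "2 * hform (- (- v + ((1 + l) * z) *s c) + (- (1 + l) * y) *s b) a = (1 + l) * x"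
    using e(1) unfolding v_def hform_sesquilinear unit by algebra
  hence 3: "complex_reflection a (- (- v + ((1 + l) * z) *s c) + (- (1 + l) * y) *s b) =
     - (- (- v + ((1 + l) * z) *s c) + (- (1 + l) * y) *s b) + ((1 + l) * x) *s a"
    by (simp add: complex_reflection_def unit)
  have "(complex_reflection a \<circ> complex_reflection b \<circ> complex_reflection c) v = l *s v"
    unfolding comp_apply 1 2 3 by (simp add: v_def vec_eq_iff algebra_simps)
  ultimately show ?thesis by blast
qed

text \<open>Unit polar vectors \<open>a\<close>, \<open>b\<close>, \<open>c\<close> stand for $c_1,
  c_2, c_3$. The real part of the triple product encodes the cosine of its argument without a
  division.\<close>

definition gram_triangle ::
    "real \<Rightarrow> real \<Rightarrow> real \<Rightarrow> real \<Rightarrow> complex ^ 3 \<Rightarrow> complex ^ 3 \<Rightarrow> complex ^ 3 \<Rightarrow> bool" where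
  "gram_triangle r1 r2 r3 t a b c \<longleftrightarrow>
     hform a a = 1 \<and> hform b b = 1 \<and> hform c c = 1 \<and>
     cmod (hform c b) = r1 \<and> cmod (hform a c) = r2 \<and> cmod (hform b a) = r3 \<and>
     Re (hform c b * hform a c * hform b a) = r1 * r2 * r3 * t"

lemma hform_mult_swap: "hform u v * hform v u = complex_of_real ((cmod (hform u v))\<^sup>2)"
  by (metis cnj_hform complex_norm_square)

text \<open>The word is the product of the reflections in \<open>a\<close> and in the image
  \<open>b'\<close> of \<open>b\<close> under \<open>complex_reflection c\<close>, and
  \<open>d\<close> is the squared modulus of \<open>hform a b'\<close>. The value
  \<open>d = 1\<close> is left open.\<close>

lemma word_A_elliptic:
  assumes "gram_triangle r1 r2 r3 t a b c"
  defines "f \<equiv> complex_reflection a \<circ> complex_reflection c \<circ> complex_reflection b \<circ> complex_reflection c"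
  defines "d \<equiv> r3\<^sup>2 + 4 * r1\<^sup>2 * r2\<^sup>2 - 4 * r1 * r2 * r3 * t"
  shows "elliptic f \<Longrightarrow> d \<le> 1" and "d < 1 \<Longrightarrow> elliptic f"
proof -
  have unit: "hform a a = 1" "hform b b = 1" "hform c c = 1"
    using assms(1) by (auto simp: gram_triangle_def)
  define b' where "b' = complex_reflection c b"
  have b': "hform b' b' = 1"
    using form_isometry_reflection[OF unit(3)] unit by (simp add: form_isometry_def b'_def)
  have f: "f = complex_reflection a \<circ> complex_reflection b'"
    unfolding f_def b'_def complex_reflection_reflect[OF unit(2,3)] by (simp add: o_assoc)
  have ab': "hform a b' = 2 * (hform c b * hform a c) - hform a b"
    by (simp add: b'_def complex_reflection_def unit hform_sesquilinear cnj_hform)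
  define X where "X = hform c b * hform a c"
  have "(cmod (2 * X - w))\<^sup>2 = 4 * (cmod X)\<^sup>2 + (cmod w)\<^sup>2 - 4 * Re (X * cnj w)" for w
    unfolding cmod_power2 by (simp add: power2_eq_square algebra_simps)
  from this[of "hform a b"]
  have "(cmod (hform a b'))\<^sup>2 = 4 * (r1 * r2)\<^sup>2 + (cmod (hform a b))\<^sup>2 - 4 * (r1 * r2 * r3 * t)"
    unfolding ab' X_def cnj_hform using assms(1) by (simp add: gram_triangle_def norm_mult)
  moreover have "cmod (hform a b) = r3"
    using assms(1) by (metis gram_triangle_def cnj_hform complex_mod_cnj)
  ultimately have d: "(cmod (hform a b'))\<^sup>2 = d" by (simp add: d_def power_mult_distrib)
  show "elliptic f \<Longrightarrow> d \<le> 1"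
    unfolding f d[symmetric] using cmod_hform_le_1_if_elliptic[OF unit(1) b'] by (simp add: abs_square_le_1)
  show "d < 1 \<Longrightarrow> elliptic f"
    unfolding f d[symmetric] using elliptic_reflection_product[OF unit(1) b'] by (simp add: abs_square_less_1)
qed

text \<open>A negative Gram determinant makes the polar vectors a basis, so every root of the cubic
  is an eigenvalue. Here \<open>w\<close> and \<open>g\<close> are the coordinates of the trace in
  which the deltoid is a cuspidal region.\<close>

lemma word_B_elliptic:
  assumes "gram_triangle r1 r2 r3 t a b c"
    and det: "1 + 2 * r1 * r2 * r3 * t - (r1\<^sup>2 + r2\<^sup>2 + r3\<^sup>2) < 0"
  defines "f \<equiv> complex_reflection a \<circ> complex_reflection b \<circ> complex_reflection c"
  defines "w \<equiv> 9 - 8 * (r1\<^sup>2 + r2\<^sup>2 + r3\<^sup>2) + 16 * r1 * r2 * r3 * t"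
  defines "g \<equiv> cusp_gap (r1\<^sup>2) (r2\<^sup>2) (r3\<^sup>2) w"
  shows "elliptic f \<Longrightarrow> g\<^sup>2 \<le> 4 * w ^ 3" and "g\<^sup>2 < 4 * w ^ 3 \<Longrightarrow> elliptic f"
proof -
  have unit: "hform a a = 1" "hform b b = 1" "hform c c = 1"
    using assms(1) by (auto simp: gram_triangle_def)
  have f: "form_isometry f"
    unfolding f_def using unit by (intro form_isometry_comp form_isometry_reflection)
  define G where "G = hform c b * hform a c * hform b a"
  have G: "Re G = r1 * r2 * r3 * t" "cmod G = r1 * r2 * r3"
    using assms(1) by (simp_all add: gram_triangle_def G_def norm_mult)
  have sq: "hform b c * hform c b = of_real (r1\<^sup>2)" "hform a c * hform c a = of_real (r2\<^sup>2)"
    "hform a b * hform b a = of_real (r3\<^sup>2)"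
    using hform_mult_swap[of c b] hform_mult_swap[of a c] hform_mult_swap[of b a] assms(1)
    by (simp_all add: gram_triangle_def mult.commute)
  define \<tau> where "\<tau> = 3 - 4 * (hform b c * hform c b + hform a c * hform c a + hform a b * hform b a) + 8 * G"
  have \<tau>: "\<tau> = complex_of_real (3 - 4 * (r1\<^sup>2 + r2\<^sup>2 + r3\<^sup>2)) + 8 * G"
    unfolding \<tau>_def sq by simp
  have "cnj G = hform c a * hform a b * hform b c" by (simp add: G_def cnj_hform)
  hence "1 + hform b a * hform c b * hform a c + hform c a * hform a b * hform b c
      - hform b c * hform c b - hform b a * hform a b - hform c a * hform a c =
      complex_of_real (1 + 2 * Re G - (r1\<^sup>2 + r2\<^sup>2 + r3\<^sup>2))"
    using sq complex_add_cnj[of G] by (simp add: G_def algebra_simps)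
  also have "\<dots> \<noteq> 0" unfolding G of_real_eq_0_iff using det by simp
  finally have eig: "l ^ 3 - \<tau> * l\<^sup>2 + cnj \<tau> * l - 1 = 0 \<Longrightarrow> \<exists>v. v \<noteq> 0 \<and> f v = l *s v" for l
    unfolding f_def using reflection_word_eigenvector[OF unit] \<tau>_def[unfolded G_def] by blast
  note ell = elliptic_and_deltoid[of f \<tau>, OF f eig]
  have "2 * Re \<tau> + 3 = w" by (simp add: \<tau> G w_def)
  moreover have "(cmod \<tau>)\<^sup>2 + 12 * Re \<tau> + 9 = g"
  proof -
    define s where "s = 3 - 4 * (r1\<^sup>2 + r2\<^sup>2 + r3\<^sup>2)"
    have "(cmod \<tau>)\<^sup>2 = s\<^sup>2 + 16 * s * Re G + 64 * (cmod G)\<^sup>2"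
      unfolding \<tau> s_def[symmetric] cmod_power2 by (simp add: power2_eq_square algebra_simps)
    moreover have "Re \<tau> = s + 8 * Re G" by (simp add: \<tau> s_def)
    ultimately show ?thesis unfolding G g_def cusp_gap_def w_def s_def
      by (simp add: power2_eq_square algebra_simps)
  qed
  ultimately have "deltoid \<tau> = g\<^sup>2 - 4 * w ^ 3" by (simp add: deltoid_def)
  thus "elliptic f \<Longrightarrow> g\<^sup>2 \<le> 4 * w ^ 3" and "g\<^sup>2 < 4 * w ^ 3 \<Longrightarrow> elliptic f"
    using ell by auto
qed

text \<open>Explicit coordinates with \<open>a\<close> the first unit vector. For
  \<open>r3 = 1\<close> the vectors \<open>a\<close> and \<open>b\<close> span a degenerate plane,
  and \<open>b\<close> is \<open>a\<close> plus a null vector.\<close>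

lemma gram_triangle_exists:
  assumes r: "0 < r1" "0 < r2" "0 < r3" "r1 \<le> 1" "r2 \<le> 1" "r3 \<le> 1"
    and t: "-1 \<le> t" "t \<le> 1"
    and det: "1 + 2 * r1 * r2 * r3 * t - (r1\<^sup>2 + r2\<^sup>2 + r3\<^sup>2) < 0"
  shows "\<exists>a b c. gram_triangle r1 r2 r3 t a b c"
proof -
  define e where "e = Complex t (sqrt (1 - t\<^sup>2))"
  have "t\<^sup>2 \<le> 1" using t by (simp add: abs_square_le_1 abs_le_iff)
  hence e: "Re e = t" "cmod e = 1" by (simp_all add: e_def cmod_def)
  \<comment> \<open>The first coordinate of \<open>c\<close>; it carries the whole phase of the
    triple product.\<close>
  define \<alpha> where "\<alpha> = of_real r2 * cnj e"
  have \<alpha>: "cmod \<alpha> = r2" "Re \<alpha> = r2 * t" using e r by (simp_all add: \<alpha>_def norm_mult)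
  have \<alpha>2: "(Re \<alpha>)\<^sup>2 + (Im \<alpha>)\<^sup>2 = r2\<^sup>2" using \<alpha>(1) by (metis cmod_power2)
  define a :: "complex ^ 3" where "a = vector [1, 0, 0]"
  have aa: "hform a a = 1" by (simp add: a_def hform_def vector_3)
  show ?thesis
  proof (cases "r3 = 1")
    case False
    define s where "s = sqrt (1 - r3\<^sup>2)"
    have "r3\<^sup>2 < 1" using False r by (simp add: abs_square_less_1)
    hence s: "s > 0" "s\<^sup>2 = 1 - r3\<^sup>2" by (simp_all add: s_def)
    \<comment> \<open>The solution of \<open>hform c b = of_real r1\<close> for the second
      coordinate of \<open>c\<close>.\<close>
    define \<beta> where "\<beta> = (of_real r1 - \<alpha> * of_real r3) / of_real s"
    define b :: "complex ^ 3" where "b = vector [of_real r3, of_real s, 0]"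
    have "(cmod (of_real r1 - \<alpha> * of_real r3))\<^sup>2 = r1\<^sup>2 + r3\<^sup>2 * ((Re \<alpha>)\<^sup>2 + (Im \<alpha>)\<^sup>2) - 2 * r1 * r3 * Re \<alpha>"
      unfolding cmod_power2 by (simp add: power2_eq_square algebra_simps)
    also have "\<dots> = r1\<^sup>2 + r3\<^sup>2 * r2\<^sup>2 - 2 * r1 * r2 * r3 * t" unfolding \<alpha>2 unfolding \<alpha> by simp
    finally have "(cmod \<beta>)\<^sup>2 * s\<^sup>2 = r1\<^sup>2 + r3\<^sup>2 * r2\<^sup>2 - 2 * r1 * r2 * r3 * t"
      using s(1) by (simp add: \<beta>_def norm_divide power_divide)
    \<comment> \<open>The right side is minus the Gram determinant. Its positivity gives a real
      third coordinate with \<open>hform c c = 1\<close>.\<close>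
    hence "(r2\<^sup>2 + (cmod \<beta>)\<^sup>2 - 1) * s\<^sup>2 = r1\<^sup>2 + r2\<^sup>2 + r3\<^sup>2 - 1 - 2 * r1 * r2 * r3 * t"
      using s(2) by algebra
    hence "(r2\<^sup>2 + (cmod \<beta>)\<^sup>2 - 1) * s\<^sup>2 > 0" using det by simp
    hence pos: "r2\<^sup>2 + (cmod \<beta>)\<^sup>2 - 1 > 0" using s(1) by (simp add: zero_less_mult_iff)
    define \<gamma> where "\<gamma> = sqrt (r2\<^sup>2 + (cmod \<beta>)\<^sup>2 - 1)"
    have \<gamma>: "\<gamma>\<^sup>2 = r2\<^sup>2 + (cmod \<beta>)\<^sup>2 - 1" using pos by (simp add: \<gamma>_def)
    define c :: "complex ^ 3" where "c = vector [\<alpha>, \<beta>, of_real \<gamma>]"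
    have "hform b b = of_real (r3\<^sup>2 + s\<^sup>2)" by (simp add: b_def hform_def vector_3 power2_eq_square)
    hence bb: "hform b b = 1" using s by simp
    have "hnorm c = 1" using \<gamma> \<alpha> by (simp add: hnorm_eq c_def vector_3)
    hence cc: "hform c c = 1" by (simp add: hform_self)
    have cb: "hform c b = of_real r1" using s by (simp add: b_def c_def hform_def vector_3 \<beta>_def)
    have ac: "hform a c = cnj \<alpha>" by (simp add: a_def c_def hform_def vector_3)
    have ba: "hform b a = of_real r3" by (simp add: a_def b_def hform_def vector_3)
    have "gram_triangle r1 r2 r3 t a b c"
      using r \<alpha> by (simp add: gram_triangle_def aa bb cc cb ac ba)
    thus ?thesis by blast
  next
    case True
    define \<delta> where "\<delta> = of_real r1 - \<alpha>"
    have "(cmod \<delta>)\<^sup>2 = r1\<^sup>2 + ((Re \<alpha>)\<^sup>2 + (Im \<alpha>)\<^sup>2) - 2 * r1 * Re \<alpha>"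
      unfolding cmod_power2 \<delta>_def by (simp add: power2_eq_square algebra_simps)
    also have "\<dots> > 0" unfolding \<alpha>2 unfolding \<alpha> using det True by simp
    finally have \<delta>: "\<delta> \<noteq> 0" by auto
    \<comment> \<open>\<open>\<delta>\<close> and \<open>\<sigma>\<close> are the difference and the
      sum of the last two coordinates of \<open>c\<close>: the former yields
      \<open>hform c b = of_real r1\<close>, the latter \<open>hform c c = 1\<close>.\<close>
    define \<sigma> where "\<sigma> = of_real (1 - r2\<^sup>2) / cnj \<delta>"
    have \<sigma>: "\<sigma> * cnj \<delta> = of_real (1 - r2\<^sup>2)" using \<delta> by (simp add: \<sigma>_def)
    define b :: "complex ^ 3" where "b = vector [1, 1, 1]"
    define c :: "complex ^ 3" where "c = vector [\<alpha>, (\<sigma> + \<delta>) / 2, (\<sigma> - \<delta>) / 2]"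
    have "(cmod ((\<sigma> + \<delta>) / 2))\<^sup>2 - (cmod ((\<sigma> - \<delta>) / 2))\<^sup>2 = Re (\<sigma> * cnj \<delta>)"
      unfolding cmod_power2 by (simp add: power2_eq_square field_simps)
    hence "hnorm c = 1" using \<alpha> by (simp add: hnorm_eq c_def vector_3 \<sigma>)
    hence cc: "hform c c = 1" by (simp add: hform_self)
    have bb: "hform b b = 1" by (simp add: b_def hform_def vector_3)
    have "hform c b = \<alpha> + \<delta>" by (simp add: b_def c_def hform_def vector_3 field_simps)
    hence cb: "hform c b = of_real r1" by (simp add: \<delta>_def)
    have ac: "hform a c = cnj \<alpha>" by (simp add: a_def c_def hform_def vector_3)
    have ba: "hform b a = 1" by (simp add: a_def b_def hform_def vector_3)
    have "gram_triangle r1 r2 r3 t a b c"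
      using r \<alpha> True by (simp add: gram_triangle_def aa bb cc cb ac ba)
    thus ?thesis by blast
  qed
qed

section \<open>Passing between triangles and normalized Gram data\<close>

lemma three_arith: "(0::3) = 3" "(1::3) - 1 = 3" "(2::3) - 1 = 1" "(3::3) - 1 = 2"
  "(1::3) + 1 = 2" "(2::3) + 1 = 3" "(3::3) + 1 = 1" "(4::3) = 1"
  by simp_all

lemma prod_UNIV_3: "(\<Prod>k\<in>UNIV. f k) = f 1 * f 2 * f (3::3)"
  unfolding UNIV_3 by (simp add: mult.assoc)

lemma triangle_prod:
  "(\<Prod>k\<in>UNIV. hform (c (k - 1)) (c (k + 1))) =
     hform (c 3) (c 2) * hform (c 1) (c (3::3)) * hform (c 2) (c 1)"
  unfolding prod_UNIV_3 three_arith ..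

lemma cos_Arg_eq: "z \<noteq> 0 \<Longrightarrow> cos (Arg z) = Re z / cmod z"
  using arg_cong[OF Arg_eq, of z Re] by (simp add: Re_exp)

lemma complex_reflection_scale:
  assumes "s \<noteq> 0"
  shows "complex_reflection (complex_of_real s *s c) = complex_reflection c"
  using assms by (auto simp: complex_reflection_def hform_sesquilinear fun_eq_iff vec_eq_iff)

text \<open>Positive rescaling of the polar vectors changes neither the reflections nor the angles
  nor the argument. Positive coefficients keep the triple product nonzero, so its argument is
  meaningful.\<close>

lemma gram_triangle_of_triangle:
  assumes tri: "triangle n c" and r: "\<And>k. 0 < r_coeff n k"
  obtains a b d where "gram_triangle (r_coeff n 1) (r_coeff n 2) (r_coeff n 3) (triangle_param c) a b d"
    "complex_reflection a = complex_reflection (c 1)"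
    "complex_reflection b = complex_reflection (c 2)"
    "complex_reflection d = complex_reflection (c 3)"
proof -
  define s where "s k = 1 / sqrt (hnorm (c k))" for k
  have pos: "hnorm (c k) > 0" for k using tri by (simp add: triangle_def polar_def)
  hence s: "s k > 0" and s2: "s k * s k * hnorm (c k) = 1" for k
  proof -
    have "hnorm (c k) > 0" by (rule pos)
    thus "s k > 0" "s k * s k * hnorm (c k) = 1" by (simp_all add: s_def)
  qed
  define e where "e k = complex_of_real (s k) *s c k" for k
  have refl: "complex_reflection (e k) = complex_reflection (c k)" for k
    unfolding e_def using s[of k] by (intro complex_reflection_scale) simp
  have unit: "hform (e k) (e k) = 1" for k
  proof -
    have "hform (e k) (e k) = of_real (s k * s k * hnorm (c k))"
      unfolding e_def hform_scale_left hform_scale_right by (simp add: hform_self)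
    thus ?thesis unfolding s2 by simp
  qed
  have he: "hform (e j) (e k) = of_real (s j * s k) * hform (c j) (c k)" for j k
    by (simp add: e_def hform_sesquilinear)
  have "cmod (hform (e j) (e k)) = cmod (hform (c j) (c k)) / (sqrt (hnorm (c j)) * sqrt (hnorm (c k)))"
    for j k
  proof -
    have "cmod (hform (e j) (e k)) = s j * s k * cmod (hform (c j) (c k))"
      unfolding he norm_mult using s[of j] s[of k] by (simp add: norm_mult)
    thus ?thesis by (simp add: s_def)
  qed
  hence angle: "cmod (hform (e (k - 1)) (e (k + 1))) = r_coeff n k" for k
    using tri by (simp add: triangle_def meet_at_angle_def r_coeff_def)
  define g where "g = hform (e 3) (e 2) * hform (e 1) (e 3) * hform (e 2) (e 1)"
  have cm: "cmod (hform (e 3) (e 2)) = r_coeff n 1" "cmod (hform (e 1) (e 3)) = r_coeff n 2"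
    "cmod (hform (e 2) (e 1)) = r_coeff n 3"
    using angle[of 1] angle[of 2] angle[of 3] by (simp_all add: three_arith)
  have g: "cmod g = r_coeff n 1 * r_coeff n 2 * r_coeff n 3" by (simp add: g_def norm_mult cm)
  hence g0: "g \<noteq> 0" using r[of 1] r[of 2] r[of 3] by auto
  have "(\<Prod>k\<in>UNIV. hform (c (k - 1)) (c (k + 1))) / (\<Prod>k\<in>UNIV. hform (c k) (c k)) = g"
  proof -
    have "(\<Prod>k\<in>UNIV. hform (c (k - 1)) (c (k + 1))) / (\<Prod>k\<in>UNIV. hform (c k) (c k)) =
        hform (c 3) (c 2) * hform (c 1) (c 3) * hform (c 2) (c 1) /
        of_real (hnorm (c 1) * hnorm (c 2) * hnorm (c 3))"
      unfolding triangle_prod prod_UNIV_3 hform_self by simp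
    \<comment> \<open>Each vector occurs twice in the triple product, so each scaling factor appears
      squared.\<close>
    moreover have "g * of_real (hnorm (c 1) * hnorm (c 2) * hnorm (c 3)) =
        hform (c 3) (c 2) * hform (c 1) (c 3) * hform (c 2) (c 1) *
        of_real ((s 1 * s 1 * hnorm (c 1)) * (s 2 * s 2 * hnorm (c 2)) * (s 3 * s 3 * hnorm (c 3)))"
      by (simp add: g_def he algebra_simps)
    hence "hform (c 3) (c 2) * hform (c 1) (c 3) * hform (c 2) (c 1) =
        g * of_real (hnorm (c 1) * hnorm (c 2) * hnorm (c 3))"
      unfolding s2 by simp
    moreover have "complex_of_real (hnorm (c 1) * hnorm (c 2) * hnorm (c 3)) \<noteq> 0"
      using pos[of 1] pos[of 2] pos[of 3] by simp
    ultimately show ?thesis by simp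
  qed
  hence "triangle_param c = Re g / cmod g" by (simp add: triangle_param_def cos_Arg_eq g0)
  hence "Re g = cmod g * triangle_param c" using g0 by simp
  hence "gram_triangle (r_coeff n 1) (r_coeff n 2) (r_coeff n 3) (triangle_param c) (e 1) (e 2) (e 3)"
    using g by (simp add: gram_triangle_def unit cm g_def)
  thus ?thesis using that refl by blast
qed

lemma triangle_of_gram_triangle:
  assumes gram: "gram_triangle (r_coeff n 1) (r_coeff n 2) (r_coeff n 3) t a b d"
    and r: "\<And>k. 0 < r_coeff n k"
  defines "c \<equiv> \<lambda>k::3. if k = 1 then a else if k = 2 then b else d"
  shows "triangle n c" and "triangle_param c = t"
proof -
  have c: "c 1 = a" "c 2 = b" "c 3 = d" by (simp_all add: c_def)
  have unit: "hform (c k) (c k) = 1" for k using gram by (simp add: c_def gram_triangle_def)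
  hence hn: "hnorm (c k) = 1" for k by (simp add: hnorm_def)
  have "cmod (hform (c (k - 1)) (c (k + 1))) = r_coeff n k" for k
    using exhaust_3[of k] gram by (auto simp: three_arith c gram_triangle_def)
  thus "triangle n c" by (simp add: triangle_def polar_def hn meet_at_angle_def r_coeff_def)
  define g where "g = hform d b * hform a d * hform b a"
  have g: "cmod g = r_coeff n 1 * r_coeff n 2 * r_coeff n 3"
    "Re g = r_coeff n 1 * r_coeff n 2 * r_coeff n 3 * t"
    using gram by (auto simp: g_def norm_mult gram_triangle_def)
  hence g0: "g \<noteq> 0" using r[of 1] r[of 2] r[of 3] by auto
  have "(\<Prod>k\<in>UNIV. hform (c (k - 1)) (c (k + 1))) = g"
    by (simp add: triangle_prod c g_def)
  hence "triangle_param c = Re g / cmod g" by (simp add: triangle_param_def unit cos_Arg_eq g0)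
  also have "\<dots> = cmod g * t / cmod g" by (simp only: g)
  finally show "triangle_param c = t" using g0 by simp
qed

section \<open>Coefficients and ellipticity parameters of a triple\<close>

lemma pi_over_bounds: "3 \<le> m \<Longrightarrow> 0 \<le> pi_over m \<and> pi_over m \<le> pi / 3"
  by (cases m) (auto simp: pi_over_def numeral_eq_enat field_simps)

lemma pi_over_less: "3 \<le> m \<Longrightarrow> m < m' \<Longrightarrow> pi_over m' < pi_over m"
  by (cases m; cases m') (auto simp: pi_over_def numeral_eq_enat intro!: divide_strict_left_mono)

lemma r_coeff_less:
  assumes "3 \<le> n k" "n k < m j"
  shows "r_coeff n k < r_coeff m j"
proof -
  have "pi_over (n k) \<le> pi" using pi_over_bounds[OF assms(1)] pi_gt_zero by linarith
  moreover have "0 \<le> pi_over (m j)" using pi_over_bounds[of "m j"] assms by simp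
  ultimately show ?thesis
    unfolding r_coeff_def by (intro cos_monotone_0_pi pi_over_less assms)
qed

lemma r_coeff_le: "3 \<le> n k \<Longrightarrow> n k \<le> m j \<Longrightarrow> r_coeff n k \<le> r_coeff m j"
  using r_coeff_less[of n k m j] by (cases "n k = m j") (auto simp: r_coeff_def order.strict_iff_order)

lemma r_coeff_eq_3: "n k = 3 \<Longrightarrow> r_coeff n k = 1/2"
  by (simp add: r_coeff_def pi_over_def numeral_eq_enat cos_60)

lemma r_coeff_bounds:
  assumes "3 \<le> n k"
  shows "1/2 \<le> r_coeff n k" "r_coeff n k \<le> 1"
  using r_coeff_le[of "\<lambda>_. 3" k n k] assms r_coeff_eq_3[of "\<lambda>_. 3" k] by (simp_all add: r_coeff_def)

lemma r_coeff_sq_less: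
  assumes "3 \<le> n k" "n k < m j"
  shows "(r_coeff n k)\<^sup>2 < (r_coeff m j)\<^sup>2"
  using r_coeff_less[of n k m j] r_coeff_bounds(1)[of n k] assms by (intro power_strict_mono) auto

lemma r_coeff_sq_ge_half:
  assumes "3 \<le> n k" "n k \<noteq> 3"
  shows "1/2 \<le> (r_coeff n k)\<^sup>2"
proof -
  have "4 \<le> n k" using assms by (cases "n k") (auto simp: numeral_eq_enat)
  hence "r_coeff (\<lambda>_. 4) k \<le> r_coeff n k" by (intro r_coeff_le) auto
  moreover have "r_coeff (\<lambda>_. 4) k = sqrt 2 / 2"
    by (simp add: r_coeff_def pi_over_def numeral_eq_enat cos_45)
  ultimately have "(sqrt 2 / 2)\<^sup>2 \<le> (r_coeff n k)\<^sup>2" by (intro power_mono) auto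
  thus ?thesis by (simp add: power_divide)
qed

text \<open>The solution in \<open>t\<close> of \<open>d = 1\<close>, with \<open>d\<close> as in
  \<open>word_A_elliptic\<close>.\<close>

definition t_A :: "(3 \<Rightarrow> enat) \<Rightarrow> real" where
  "t_A n = ((r_coeff n 3)\<^sup>2 + 4 * (r_coeff n 1)\<^sup>2 * (r_coeff n 2)\<^sup>2 - 1)
     / (4 * r_coeff n 1 * r_coeff n 2 * r_coeff n 3)"

text \<open>The coordinate $w = 2 Re \<tau> + 3$ of the trace of $W_B$, as an affine function of
  \<open>t\<close>.\<close>

definition cusp_abscissa :: "(3 \<Rightarrow> enat) \<Rightarrow> real \<Rightarrow> real" where
  "cusp_abscissa n t = 9 - 8 * ((r_coeff n 1)\<^sup>2 + (r_coeff n 2)\<^sup>2 + (r_coeff n 3)\<^sup>2)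
     + 16 * r_coeff n 1 * r_coeff n 2 * r_coeff n 3 * t"

abbreviation triple_gap :: "(3 \<Rightarrow> enat) \<Rightarrow> real \<Rightarrow> real" where
  "triple_gap n \<equiv> cusp_gap ((r_coeff n 1)\<^sup>2) ((r_coeff n 2)\<^sup>2) ((r_coeff n 3)\<^sup>2)"

abbreviation triple_height :: "(3 \<Rightarrow> enat) \<Rightarrow> real" where
  "triple_height n \<equiv> cusp_height ((r_coeff n 1)\<^sup>2) ((r_coeff n 2)\<^sup>2) ((r_coeff n 3)\<^sup>2)"

section \<open>Ellipticity parameters of a triple with entries at least 3\<close>

context
  fixes n :: "3 \<Rightarrow> enat"
  assumes n: "\<And>k. 3 \<le> n k"
begin

lemma r_pos: "0 < r_coeff n k" and r_le_1: "r_coeff n k \<le> 1" and r_ge_half: "1/2 \<le> r_coeff n k"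
  using r_coeff_bounds[of n k] n by auto

lemma r_nonneg: "0 \<le> r_coeff n k"
  using r_pos[of k] by simp

lemma r_prod_pos: "0 < r_coeff n 1 * r_coeff n 2 * r_coeff n 3"
  using r_pos by simp

lemma gram_det_neg:
  assumes "t \<in> deformation_space n"
  shows "1 + 2 * r_coeff n 1 * r_coeff n 2 * r_coeff n 3 * t
    - ((r_coeff n 1)\<^sup>2 + (r_coeff n 2)\<^sup>2 + (r_coeff n 3)\<^sup>2) < 0"
proof -
  have "t < ((r_coeff n 1)\<^sup>2 + (r_coeff n 2)\<^sup>2 + (r_coeff n 3)\<^sup>2 - 1)
      / (2 * r_coeff n 1 * r_coeff n 2 * r_coeff n 3)"
    using assms by (simp add: deformation_space_def t_upper_def)
  moreover have "0 < 2 * r_coeff n 1 * r_coeff n 2 * r_coeff n 3" using r_pos by simp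
  ultimately show ?thesis by (simp add: pos_less_divide_eq algebra_simps)
qed

lemma triangle_exists:
  assumes "t \<in> deformation_space n"
  obtains c where "triangle n c" "triangle_param c = t"
    "gram_triangle (r_coeff n 1) (r_coeff n 2) (r_coeff n 3) t (c 1) (c 2) (c 3)"
proof -
  have "-1 \<le> t" "t \<le> 1" using assms by (auto simp: deformation_space_def t_upper_def)
  then obtain a b d where gram: "gram_triangle (r_coeff n 1) (r_coeff n 2) (r_coeff n 3) t a b d"
    using gram_triangle_exists[of "r_coeff n 1" "r_coeff n 2" "r_coeff n 3" t]
      gram_det_neg[OF assms] r_pos r_le_1 by blast
  define c where "c = (\<lambda>k::3. if k = 1 then a else if k = 2 then b else d)"
  have "c 1 = a" "c 2 = b" "c 3 = d" by (simp_all add: c_def)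
  with that[of c] triangle_of_gram_triangle[OF gram r_pos] gram show ?thesis
    unfolding c_def[symmetric] by simp
qed

lemma t_A_le_iff: "t_A n \<le> t \<longleftrightarrow> (r_coeff n 3)\<^sup>2 + 4 * (r_coeff n 1)\<^sup>2 * (r_coeff n 2)\<^sup>2
    - 4 * r_coeff n 1 * r_coeff n 2 * r_coeff n 3 * t \<le> 1"
  and t_A_less_iff: "t_A n < t \<longleftrightarrow> (r_coeff n 3)\<^sup>2 + 4 * (r_coeff n 1)\<^sup>2 * (r_coeff n 2)\<^sup>2
    - 4 * r_coeff n 1 * r_coeff n 2 * r_coeff n 3 * t < 1"
proof -
  have p: "0 < 4 * r_coeff n 1 * r_coeff n 2 * r_coeff n 3" using r_pos by simp
  show "t_A n \<le> t \<longleftrightarrow> (r_coeff n 3)\<^sup>2 + 4 * (r_coeff n 1)\<^sup>2 * (r_coeff n 2)\<^sup>2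
      - 4 * r_coeff n 1 * r_coeff n 2 * r_coeff n 3 * t \<le> 1"
    unfolding t_A_def pos_divide_le_eq[OF p] by (simp add: mult.commute) linarith
  show "t_A n < t \<longleftrightarrow> (r_coeff n 3)\<^sup>2 + 4 * (r_coeff n 1)\<^sup>2 * (r_coeff n 2)\<^sup>2
      - 4 * r_coeff n 1 * r_coeff n 2 * r_coeff n 3 * t < 1"
    unfolding t_A_def pos_divide_less_eq[OF p] by (simp add: mult.commute) linarith
qed

lemma cusp_abscissa_t_A: "cusp_abscissa n (t_A n) = triple_height n"
proof -
  have "4 * r_coeff n 1 * r_coeff n 2 * r_coeff n 3 * t_A n =
      (r_coeff n 3)\<^sup>2 + 4 * (r_coeff n 1)\<^sup>2 * (r_coeff n 2)\<^sup>2 - 1"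
    using r_pos[of 1] r_pos[of 2] r_pos[of 3] by (simp add: t_A_def)
  thus ?thesis unfolding cusp_abscissa_def cusp_height_def by algebra
qed

lemma cusp_abscissa_mono:
  assumes "s \<le> t"
  shows "cusp_abscissa n s \<le> cusp_abscissa n t"
  using mult_left_mono[OF assms, of "16 * r_coeff n 1 * r_coeff n 2 * r_coeff n 3"] r_prod_pos
  by (simp add: cusp_abscissa_def)

lemma elliptic_params_A_imp: "t \<in> elliptic_params word_A n \<Longrightarrow> t_A n \<le> t"
proof -
  assume "t \<in> elliptic_params word_A n"
  then obtain c where c: "triangle n c" "triangle_param c = t" "elliptic (word_A c)"
    by (auto simp: elliptic_params_def)
  obtain a b d where g: "gram_triangle (r_coeff n 1) (r_coeff n 2) (r_coeff n 3) t a b d"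
    "complex_reflection a = complex_reflection (c 1)"
    "complex_reflection b = complex_reflection (c 2)"
    "complex_reflection d = complex_reflection (c 3)"
    using gram_triangle_of_triangle[OF c(1) r_pos] unfolding c(2) .
  show "t_A n \<le> t"
    unfolding t_A_le_iff using word_A_elliptic(1)[OF g(1)] c(3) by (simp add: word_A_def g)
qed

lemma elliptic_params_A_if:
  assumes "t \<in> deformation_space n" "t_A n < t"
  shows "t \<in> elliptic_params word_A n"
proof -
  obtain c where c: "triangle n c" "triangle_param c = t"
    "gram_triangle (r_coeff n 1) (r_coeff n 2) (r_coeff n 3) t (c 1) (c 2) (c 3)"
    using triangle_exists[OF assms(1)] .
  have "elliptic (word_A c)"
    unfolding word_A_def using word_A_elliptic(2)[OF c(3)] assms(2) t_A_less_iff by simp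
  with c assms(1) show ?thesis by (auto simp: elliptic_params_def)
qed

lemma elliptic_params_B_imp:
  assumes "t \<in> elliptic_params word_B n"
  shows "(triple_gap n (cusp_abscissa n t))\<^sup>2 \<le> 4 * cusp_abscissa n t ^ 3"
proof -
  from assms obtain c where t: "t \<in> deformation_space n"
    and c: "triangle n c" "triangle_param c = t" "elliptic (word_B c)"
    by (auto simp: elliptic_params_def)
  obtain a b d where g: "gram_triangle (r_coeff n 1) (r_coeff n 2) (r_coeff n 3) t a b d"
    "complex_reflection a = complex_reflection (c 1)"
    "complex_reflection b = complex_reflection (c 2)"
    "complex_reflection d = complex_reflection (c 3)"
    using gram_triangle_of_triangle[OF c(1) r_pos] unfolding c(2) .
  show ?thesis
    unfolding cusp_abscissa_def
    using word_B_elliptic(1)[OF g(1) gram_det_neg[OF t]] c(3) by (simp add: word_B_def g)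
qed

lemma elliptic_params_B_if:
  assumes "t \<in> deformation_space n"
    and "(triple_gap n (cusp_abscissa n t))\<^sup>2 < 4 * cusp_abscissa n t ^ 3"
  shows "t \<in> elliptic_params word_B n"
proof -
  obtain c where c: "triangle n c" "triangle_param c = t"
    "gram_triangle (r_coeff n 1) (r_coeff n 2) (r_coeff n 3) t (c 1) (c 2) (c 3)"
    using triangle_exists[OF assms(1)] .
  have "elliptic (word_B c)"
    unfolding word_B_def
    using word_B_elliptic(2)[OF c(3) gram_det_neg[OF assms(1)]] assms(2)[unfolded cusp_abscissa_def]
    by simp
  with c assms(1) show ?thesis by (auto simp: elliptic_params_def)
qed

lemma r_coeff_sq_bounds: "1/4 \<le> (r_coeff n k)\<^sup>2" "(r_coeff n k)\<^sup>2 \<le> 1"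
  using power_mono[OF r_ge_half[of k], of 2] power_mono[OF r_le_1[of k], of 2] r_pos[of k]
  by (simp_all add: power_divide)

text \<open>At \<open>t = - 1\<close> the quantity \<open>d\<close> of
  \<open>word_A_elliptic\<close> is $(2 r_1 r_2 + r_3)^2$, which is at least 1 because every
  coefficient is at least 1/2.\<close>

lemma t_A_ge: "- 1 \<le> t_A n"
proof (rule ccontr)
  define r1 where "r1 = r_coeff n 1"
  define r2 where "r2 = r_coeff n 2"
  define r3 where "r3 = r_coeff n 3"
  assume "\<not> - 1 \<le> t_A n"
  hence "r3\<^sup>2 + 4 * r1\<^sup>2 * r2\<^sup>2 + 4 * r1 * r2 * r3 < 1"
    using t_A_less_iff[of "- 1"] by (simp add: r1_def r2_def r3_def)
  hence "(2 * (r1 * r2) + r3)\<^sup>2 < 1" by (simp add: power2_eq_square algebra_simps)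
  moreover have "1/2 * (1/2) \<le> r1 * r2"
    unfolding r1_def r2_def using r_ge_half r_nonneg by (intro mult_mono) auto
  hence "1 \<le> 2 * (r1 * r2) + r3" using r_ge_half[of 3] unfolding r3_def by linarith
  hence "1 \<le> (2 * (r1 * r2) + r3)\<^sup>2" by simp
  ultimately show False by simp
qed

section \<open>Ordered triples: criteria for type A\<close>

context
  assumes mono: "n 1 \<le> n 2" "n 2 \<le> n 3"
begin

lemma r_mono: "r_coeff n 1 \<le> r_coeff n 2" "r_coeff n 2 \<le> r_coeff n 3"
  using mono n by (auto intro: r_coeff_le)

lemma r_sq_mono: "(r_coeff n 1)\<^sup>2 \<le> (r_coeff n 2)\<^sup>2" "(r_coeff n 2)\<^sup>2 \<le> (r_coeff n 3)\<^sup>2"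
  using r_mono r_nonneg by (auto intro: power_mono)

text \<open>The squared cosine is 1/4 for the entry 3 and jumps to at least 1/2 from the entry 4
  on.\<close>

lemma first_coeff_cases:
  assumes "n 3 \<noteq> 3"
  shows "1/2 \<le> (r_coeff n 1)\<^sup>2 \<or>
    (r_coeff n 1)\<^sup>2 = 1/4 \<and> 1/4 \<le> (r_coeff n 2)\<^sup>2 \<and> 1/2 \<le> (r_coeff n 3)\<^sup>2"
proof (cases "n 1 = 3")
  case True
  hence "(r_coeff n 1)\<^sup>2 = 1/4" by (simp add: r_coeff_eq_3 power_divide)
  thus ?thesis using r_coeff_sq_ge_half[of n 3] r_coeff_sq_bounds(1)[of 2] n assms by simp
qed (use r_coeff_sq_ge_half n in blast)

lemma first_coeff_large:
  assumes "n 3 \<noteq> 3" "0 < triple_height n"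
  shows "7/8 \<le> (r_coeff n 1)\<^sup>2"
proof -
  have "1/2 \<le> (r_coeff n 1)\<^sup>2" using first_coeff_cases[OF assms(1)]
  proof
    assume *: "(r_coeff n 1)\<^sup>2 = 1/4 \<and> 1/4 \<le> (r_coeff n 2)\<^sup>2 \<and> 1/2 \<le> (r_coeff n 3)\<^sup>2"
    hence "(r_coeff n 1)\<^sup>2 = 1/4" ..
    from assms(2)[unfolded cusp_height_def this] * show ?thesis by simp
  qed
  thus ?thesis
    using cusp_height_nonneg_imp r_sq_mono r_coeff_sq_bounds(2) assms(2) by (meson less_imp_le)
qed

text \<open>If the last claim failed, $W_B$ would be elliptic no later than $t_A$: at $t_A$ itself
  when the point there is strictly inside the cuspidal region, and earlier when the gap there is
  negative.\<close>

lemma type_A_imp: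
  assumes "has_type_A n"
  shows "n 3 \<noteq> 3" and "r_coeff n 1 < 1"
    and "0 < triple_height n \<Longrightarrow> 0 \<le> triple_gap n (triple_height n) \<and>
      4 * triple_height n ^ 3 \<le> (triple_gap n (triple_height n))\<^sup>2"
proof -
  obtain t where tA: "t \<in> elliptic_params word_A n"
    and tB: "\<And>s. s \<in> elliptic_params word_B n \<Longrightarrow> t < s"
    using assms by (auto simp: has_type_A_def)
  have t: "t \<in> deformation_space n" using tA by (simp add: elliptic_params_def)
  have tA: "t_A n \<le> t" using elliptic_params_A_imp[OF tA] .
  have upper: "t_A n < t_upper n" using t tA by (simp add: deformation_space_def)
  \<comment> \<open>For (3,3,3) the upper limit \<open>t_upper n\<close> is -1, so the deformation
    space is empty.\<close>
  show n3: "n 3 \<noteq> 3"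
  proof
    assume "n 3 = 3"
    hence "n k = 3" for k using n[of 1] n[of 2] mono exhaust_3[of k] by auto
    hence r: "r_coeff n k = 1/2" for k by (simp add: r_coeff_eq_3)
    show False using t unfolding deformation_space_def t_upper_def r by (simp add: power_divide)
  qed
  \<comment> \<open>If all coefficients are 1, then \<open>t_A n\<close> and
    \<open>t_upper n\<close> both equal 1.\<close>
  show "r_coeff n 1 < 1"
  proof (rule ccontr)
    assume "\<not> r_coeff n 1 < 1"
    hence r: "r_coeff n 1 = 1" "r_coeff n 2 = 1" "r_coeff n 3 = 1"
      using r_le_1[of 1] r_le_1[of 2] r_le_1[of 3] r_mono by linarith+
    show False using upper unfolding t_A_def t_upper_def r by simp
  qed
  assume pos: "0 < triple_height n"
  define q where "q = triple_height n"
  have R: "7/8 \<le> (r_coeff n 1)\<^sup>2" "7/8 \<le> (r_coeff n 2)\<^sup>2" "7/8 \<le> (r_coeff n 3)\<^sup>2"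
    using first_coeff_large[OF n3 pos] r_sq_mono by linarith+
  have "\<not> (triple_gap n q)\<^sup>2 < 4 * q ^ 3"
  proof
    assume "(triple_gap n q)\<^sup>2 < 4 * q ^ 3"
    moreover have "t_A n \<in> deformation_space n"
      using upper t_A_ge by (simp add: deformation_space_def)
    ultimately have "t_A n \<in> elliptic_params word_B n"
      using elliptic_params_B_if cusp_abscissa_t_A q_def by simp
    with tB tA show False by force
  qed
  moreover have "0 \<le> triple_gap n q"
  proof (rule ccontr)
    assume "\<not> 0 \<le> triple_gap n q"
    then obtain w where w: "0 < w" "w < q" "triple_gap n w = 0"
      using cusp_gap_zero_between[OF R(1) r_sq_mono r_coeff_sq_bounds(2) pos] q_def by auto
    define p where "p = r_coeff n 1 * r_coeff n 2 * r_coeff n 3"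
    define S where "S = (r_coeff n 1)\<^sup>2 + (r_coeff n 2)\<^sup>2 + (r_coeff n 3)\<^sup>2"
    define s where "s = (w - 9 + 8 * S) / (16 * p)"
    have p: "0 < p" using r_prod_pos p_def by simp
    have abscissa: "cusp_abscissa n u = 9 - 8 * S + 16 * p * u" for u
      by (simp add: cusp_abscissa_def S_def p_def)
    have ws: "cusp_abscissa n s = w" using p by (simp add: abscissa s_def)
    \<comment> \<open>Here \<open>8 * S\<close> is at least 21, so \<open>s\<close> stays above the
      lower end -1 of the deformation space.\<close>
    have "0 \<le> s" using p R w by (simp add: s_def S_def)
    moreover have "s < t_A n"
    proof (rule ccontr)
      assume "\<not> s < t_A n"
      hence "q \<le> w" using cusp_abscissa_mono[of "t_A n" s] cusp_abscissa_t_A ws q_def by simp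
      with w show False by simp
    qed
    ultimately have "s \<in> deformation_space n" using upper by (simp add: deformation_space_def)
    hence "s \<in> elliptic_params word_B n" using w by (intro elliptic_params_B_if) (simp_all add: ws)
    with tB tA \<open>s < t_A n\<close> show False by force
  qed
  ultimately show "0 \<le> triple_gap n (triple_height n) \<and>
      4 * triple_height n ^ 3 \<le> (triple_gap n (triple_height n))\<^sup>2" by (simp add: q_def)
qed

text \<open>At \<open>t = 1\<close> the quantity \<open>d\<close> of \<open>word_A_elliptic\<close>
  is $(2 r_1 r_2 - r_3)^2 < 1$. At the bound given by the Gram determinant, \<open>d < 1\<close>
  reduces to $(2 R_1 - 1)(2 R_2 - 1) < R_3$.\<close>

lemma t_A_less_t_upper:
  assumes "n 3 \<noteq> 3" "r_coeff n 1 < 1"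
  shows "t_A n < t_upper n"
proof -
  define r1 where "r1 = r_coeff n 1"
  define r2 where "r2 = r_coeff n 2"
  define r3 where "r3 = r_coeff n 3"
  have r: "0 < r1" "0 < r2" "0 < r3" "r1 < 1" "r2 \<le> 1" "r3 \<le> 1" "r2 \<le> r3"
    using r_pos r_le_1 r_mono assms by (auto simp: r1_def r2_def r3_def)
  have R: "r1\<^sup>2 < 1" "r1\<^sup>2 \<le> r3\<^sup>2" "r2\<^sup>2 \<le> 1" "r1\<^sup>2 \<le> r2\<^sup>2" "1/4 \<le> r1\<^sup>2" "1/4 \<le> r2\<^sup>2"
    using r r_sq_mono r_coeff_sq_bounds(1) by (auto simp: r1_def r2_def r3_def abs_square_less_1 abs_square_le_1)
  have R3: "1/2 \<le> r3\<^sup>2" using r_coeff_sq_ge_half[of n 3] n assms(1) r3_def by simp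
  have "t_A n < 1"
  proof -
    have "r1 * r2 < 1 * r3" using r by (intro mult_less_le_imp_less) auto
    moreover have "r1 * r2 < 1" using \<open>r1 * r2 < 1 * r3\<close> r by simp
    moreover have "0 < r1 * r2" using r by simp
    ultimately have "2 * (r1 * r2) - r3 < 1" "- 1 < 2 * (r1 * r2) - r3" using r by linarith+
    hence "(2 * (r1 * r2) - r3)\<^sup>2 < 1" by (simp add: abs_square_less_1 abs_less_iff)
    thus ?thesis unfolding t_A_less_iff r1_def[symmetric] r2_def[symmetric] r3_def[symmetric]
      by (simp add: power2_eq_square algebra_simps)
  qed
  moreover have "t_A n < (r1\<^sup>2 + r2\<^sup>2 + r3\<^sup>2 - 1) / (2 * r1 * r2 * r3)"
  proof -
    have "(2 * r1\<^sup>2 - 1) * (2 * r2\<^sup>2 - 1) < r3\<^sup>2"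
    proof (cases "2 * r1\<^sup>2 - 1 \<le> 0")
      case False
      have "(2 * r1\<^sup>2 - 1) * (2 * r2\<^sup>2 - 1) \<le> (2 * r1\<^sup>2 - 1) * 1"
        using False R by (intro mult_left_mono) auto
      also have "\<dots> < r3\<^sup>2" using R by simp
      finally show ?thesis .
    next
      case True
      have "(1 - 2 * r1\<^sup>2) * (1 - 2 * r2\<^sup>2) \<le> (1 - 2 * r1\<^sup>2) * (1/2)"
        using True R by (intro mult_left_mono) auto
      also have "\<dots> \<le> 1/4" using R by simp
      finally have "(1 - 2 * r1\<^sup>2) * (1 - 2 * r2\<^sup>2) \<le> 1/4" .
      moreover have "(2 * r1\<^sup>2 - 1) * (2 * r2\<^sup>2 - 1) = (1 - 2 * r1\<^sup>2) * (1 - 2 * r2\<^sup>2)"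
        by (simp add: algebra_simps)
      ultimately show ?thesis using R3 by linarith
    qed
    hence "r3\<^sup>2 + 4 * r1\<^sup>2 * r2\<^sup>2 - 2 * (r1\<^sup>2 + r2\<^sup>2 + r3\<^sup>2 - 1) < 1" by (simp add: algebra_simps)
    moreover have "4 * r1 * r2 * r3 * ((r1\<^sup>2 + r2\<^sup>2 + r3\<^sup>2 - 1) / (2 * r1 * r2 * r3)) =
        2 * (r1\<^sup>2 + r2\<^sup>2 + r3\<^sup>2 - 1)" using r by (simp add: divide_simps)
    ultimately show ?thesis
      unfolding t_A_less_iff r1_def[symmetric] r2_def[symmetric] r3_def[symmetric] by simp
  qed
  ultimately show ?thesis by (simp add: t_upper_def r1_def r2_def r3_def)
qed

text \<open>The discriminant \<open>\<phi>\<close> is positive up to and including $t_A$, hence by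
  continuity slightly beyond. A parameter in this margin makes $W_A$ elliptic and precedes every
  parameter at which $W_B$ is elliptic.\<close>

lemma type_A_if:
  assumes n3: "n 3 \<noteq> 3" and r1: "r_coeff n 1 < 1"
    and passes: "passes_cusp ((r_coeff n 1)\<^sup>2) ((r_coeff n 2)\<^sup>2) ((r_coeff n 3)\<^sup>2)"
  shows "has_type_A n"
proof -
  define \<phi> where "\<phi> t = (triple_gap n (cusp_abscissa n t))\<^sup>2 - 4 * cusp_abscissa n t ^ 3" for t
  have below: "0 < \<phi> s" if "s \<le> t_A n" for s
    using passes_cusp_disc_pos[OF passes r_sq_mono r_coeff_sq_bounds(2) first_coeff_cases[OF n3]]
      cusp_abscissa_mono[OF that] cusp_abscissa_t_A by (simp add: \<phi>_def)
  have "isCont \<phi> (t_A n)"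
    unfolding \<phi>_def cusp_gap_def cusp_abscissa_def by (intro continuous_intros)
  hence "\<forall>\<^sub>F s in at (t_A n). 0 < \<phi> s"
    using below[OF order.refl] unfolding isCont_def by (rule order_tendstoD(1))
  then obtain \<delta> where \<delta>: "0 < \<delta>" and near: "\<And>s. s \<noteq> t_A n \<Longrightarrow> dist s (t_A n) < \<delta> \<Longrightarrow> 0 < \<phi> s"
    by (auto simp: eventually_at)
  obtain t where t: "t_A n < t" "t < t_A n + \<delta>" "t < t_upper n"
    using dense[of "t_A n" "min (t_A n + \<delta>) (t_upper n)"] \<delta> t_A_less_t_upper[OF n3 r1] by auto
  have "t \<in> elliptic_params word_A n"
    using t t_A_ge by (intro elliptic_params_A_if) (auto simp: deformation_space_def)
  moreover have "t < s" if "s \<in> elliptic_params word_B n" for s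
  proof (rule ccontr)
    assume "\<not> t < s"
    hence "0 < \<phi> s" using below[of s] near[of s] t by (cases "s \<le> t_A n") (auto simp: dist_real_def)
    with elliptic_params_B_imp[OF that] show False by (simp add: \<phi>_def)
  qed
  ultimately show ?thesis by (auto simp: has_type_A_def)
qed

end

end

theorem mainTheorem2:
  fixes n n' :: "3 \<Rightarrow> enat"
  assumes "3 \<le> n 1" and "n 1 \<le> n 2" and "n 2 \<le> n 3"
    and "3 \<le> n' 1" and "n' 1 \<le> n' 2" and "n' 2 \<le> n' 3"
    and "has_type_A n"
    and "n' 1 \<le> n 1" and "n' 2 \<le> n 2" and "n' 3 \<ge> n 3"
  shows "has_type_A n'"
proof (cases "n = n'")
  case False
  then obtain k where k: "n k \<noteq> n' k" by blast
  have n: "3 \<le> n k" and n': "3 \<le> n' k" for k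
    using assms exhaust_3[of k] by auto
  have n3: "n 3 \<noteq> 3" and r1: "r_coeff n 1 < 1"
    and gap: "0 < triple_height n \<Longrightarrow> 0 \<le> triple_gap n (triple_height n) \<and>
      4 * triple_height n ^ 3 \<le> (triple_gap n (triple_height n))\<^sup>2"
    using type_A_imp[OF n assms(2,3,7)] by auto
  have n3': "n' 3 \<noteq> 3" using n3 n[of 3] assms(10) by auto
  have "r_coeff n' 1 \<le> r_coeff n 1" using n' assms(8) by (rule r_coeff_le)
  hence r1': "r_coeff n' 1 < 1" using r1 by simp
  have sq: "(r_coeff n' 1)\<^sup>2 \<le> (r_coeff n 1)\<^sup>2" "(r_coeff n' 2)\<^sup>2 \<le> (r_coeff n 2)\<^sup>2"
    "(r_coeff n 3)\<^sup>2 \<le> (r_coeff n' 3)\<^sup>2"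
    using assms n n' r_nonneg[of n, OF n] r_nonneg[of n', OF n'] by (auto intro: power_mono r_coeff_le)
  \<comment> \<open>Distinct triples differ strictly in some entry, which makes up for the weak
    inequalities in \<open>gap\<close>.\<close>
  have "n' 1 < n 1 \<or> n' 2 < n 2 \<or> n 3 < n' 3"
    using k exhaust_3[of k] assms(8-10) by auto
  hence strict: "(r_coeff n' 1)\<^sup>2 < (r_coeff n 1)\<^sup>2 \<or> (r_coeff n' 2)\<^sup>2 < (r_coeff n 2)\<^sup>2 \<or>
    (r_coeff n 3)\<^sup>2 < (r_coeff n' 3)\<^sup>2"
    using r_coeff_sq_less[of n' 1 n 1] r_coeff_sq_less[of n' 2 n 2] r_coeff_sq_less[of n 3 n' 3] n n'
    by blast
  have "1/2 \<le> (r_coeff n' 1)\<^sup>2 \<or> triple_height n' \<le> 0"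
    using first_coeff_large[OF n' assms(5,6) n3'] by force
  hence "passes_cusp ((r_coeff n' 1)\<^sup>2) ((r_coeff n' 2)\<^sup>2) ((r_coeff n' 3)\<^sup>2)"
    using r_sq_mono[OF n' assms(5,6)] r_coeff_sq_bounds(2)[of n' 3, OF n'] r_sq_mono[OF n assms(2,3)]
      sq strict gap by (intro passes_cusp_mono)
  thus ?thesis using type_A_if[OF n' assms(5,6) n3' r1'] by blast
qed (use assms in simp)

end
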